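(* For every integer $d\ge 3$ there is $k_0$ such that for all integers $k\ge k_0$ the equality $$m(k,d,2)=d-2+k+\left\lceil\frac{k}{2}\right\rceil-1$$ does not hold.
   Context: For integers $k,d,\lambda\ge 1$ with $d\ge\lambda$, and a finite set $X\subset\mathbb{R}^d$, a Kneser transversal of $X$ is a $(d-\lambda)$-plane (affine subspace of dimension $d-\lambda$) that intersects the convex hull of every $k$-element subset of $X$. The number $m(k,d,\lambda)$ is the maximum positive integer $n$ such that every set of $n$ points (not necessarily in general position) in $\mathbb{R}^d$ admits a Kneser transversal. *)

theory Defs
  imports "HOL-Analysis.Analysis"
begin

text \<open>
  The ambient space \<open>\<real>\<^sup>d\<close> is a Euclidean space type \<open>'a\<close> with \<open>d = DIM('a)\<close>.
\<close>

definition kneser_transversal ::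
    "nat \<Rightarrow> nat \<Rightarrow> 'a::euclidean_space set \<Rightarrow> 'a set \<Rightarrow> bool" where
  "kneser_transversal k l X T \<longleftrightarrow>
     affine T \<and> aff_dim T = int DIM('a) - int l \<and>
     (\<forall>S\<subseteq>X. card S = k \<longrightarrow> T \<inter> convex hull S \<noteq> {})"

text \<open>
  \<open>kneser_number TYPE('a) k l\<close> is \<open>m(k, d, l)\<close>, meaningful for \<open>k \<ge> 1\<close> and \<open>1 \<le> l \<le> d\<close>.
  For \<open>k \<ge> 1\<close> and \<open>1 \<le> l \<le> d\<close> the maximum exists: \<open>n = 1\<close> qualifies, and for points in
  general position a hyperplane containing a transversal contains at most \<open>d\<close> of the points and
  has at most \<open>k - 1\<close> of them strictly on either side, so \<open>n \<le> d + 2 * (k - 1)\<close>.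
\<close>

definition kneser_number :: "'a::euclidean_space itself \<Rightarrow> nat \<Rightarrow> nat \<Rightarrow> nat" where
  "kneser_number _ k l =
     (GREATEST n. n \<ge> 1 \<and>
        (\<forall>X :: 'a set. finite X \<and> card X = n \<longrightarrow> (\<exists>T. kneser_transversal k l X T)))"

end

theory Submission
  imports Defs
begin

text \<open>
  Put \<open>n = d - 2 + k + \<lceil>k/2\<rceil>\<close> and \<open>r = n - k\<close>, so that \<open>3 r\<close> exceeds \<open>n\<close> by a constant \<open>e\<close> depending
  only on \<open>d\<close>. Every \<open>n\<close> points have a Kneser transversal once \<open>r > 20 e\<close>; after projecting to \<open>\<real>\<^sup>3\<close>
  it suffices to find a line. Suppose no line of direction \<open>v\<close> works. By Helly's theorem in the
  plane \<open>v\<^sup>\<bottom>\<close> there are three half-planes covering that plane, each with at most \<open>r\<close> of the projected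
  points, so up to \<open>O(e)\<close> points they partition the set into three parts of size \<open>r\<close>. Any two such
  triples of half-planes give nearly the same partition, so the unordered triple of normals is
  determined by \<open>v\<close> up to averaging within classes. The product of the three class averages
  is then a nowhere vanishing continuous section of the third tensor power of the tangent bundle of
  the sphere (as a complex line bundle). That bundle has Euler number 6, a contradiction.
\<close>

section \<open>Coverings of the plane by three half-planes\<close>

text \<open>Counting alone does not force two coverings to give nearly the same partition: the 3x3
  matrix of overlaps could have all entries near \<open>r / 3\<close>. Plane geometry excludes this.
  Once both triples of normals are positively oriented, points in the three parts are oriented like
  the normals, so no odd permutation of the labels is realised by three points; and two even
  permutations are not realised at once. The matrix thus has one transversal of nonzero entries, and
  near-constant row and column sums concentrate the mass on it. The normals supplied by Helly's
  theorem are neither unique nor continuous in \<open>v\<close>, hence weighted averages; the labels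
  may be permuted as \<open>v\<close> moves around the sphere, hence the product. The averages do
  not cancel because the normals of one class lie in a common open half-plane. The strongest demands
  on \<open>r\<close> are \<open>r > 16 * e\<close>, for similarity of classes to be transitive, and
  \<open>r > 15 * e\<close>, for a point common to three sets of a class; 20 leaves slack. The
  number 6 is 3 * 2: three factors, and the Euler number 2 of the tangent bundle.\<close>

definition cross :: "complex \<Rightarrow> complex \<Rightarrow> real" where
  "cross a b = Re a * Im b - Im a * Re b"

lemma third_summand_eq:
  fixes a b c :: "'a::ab_group_add"
  shows "a + b + c = 0 \<Longrightarrow> c = - a - b"
  by (metis add.commute add_uminus_conv_diff diff_minus_eq_add eq_neg_iff_add_eq_0 minus_diff_eq)

text \<open>In terms of \<open>\<tau>\<close> and the slacks \<open>a12\<close>, ...,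
  \<open>a32\<close>, the product of the two determinants is a polynomial with nonnegative
  coefficients that contains \<open>\<tau> * \<tau>\<close>.\<close>

lemma cross_orientation:
  fixes u1 u2 u3 z1 z2 z3 :: complex
  assumes u: "u1 + u2 + u3 = 0" and t: "t1 + t2 + t3 < 0"
    and "u1 \<bullet> z2 \<le> t1" "u1 \<bullet> z3 \<le> t1" "u2 \<bullet> z1 \<le> t2" "u2 \<bullet> z3 \<le> t2" "u3 \<bullet> z1 \<le> t3" "u3 \<bullet> z2 \<le> t3"
  shows "cross u1 u2 * cross (z1 - z3) (z2 - z3) > 0"
proof -
  define \<tau> where "\<tau> = - (t1 + t2 + t3)"
  define a12 a13 a21 a23 a31 a32 where a: "a12 = t1 - u1 \<bullet> z2" "a13 = t1 - u1 \<bullet> z3"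
    "a21 = t2 - u2 \<bullet> z1" "a23 = t2 - u2 \<bullet> z3" "a31 = t3 - u3 \<bullet> z1" "a32 = t3 - u3 \<bullet> z2"
  have pos: "\<tau> > 0" "a12 \<ge> 0" "a13 \<ge> 0" "a21 \<ge> 0" "a23 \<ge> 0" "a31 \<ge> 0" "a32 \<ge> 0"
    using assms by (auto simp: a \<tau>_def)
  have u3: "u3 = - u1 - u2"
    using u by (rule third_summand_eq)
  have "cross u1 u2 * cross (z1 - z3) (z2 - z3)
      = (u1 \<bullet> z1 - u1 \<bullet> z3) * (u2 \<bullet> z2 - u2 \<bullet> z3) - (u1 \<bullet> z2 - u1 \<bullet> z3) * (u2 \<bullet> z1 - u2 \<bullet> z3)"
    by (simp add: cross_def inner_complex_def algebra_simps)
  also have "\<dots> = (\<tau> + a21 + a31 + a13) * (\<tau> + a12 + a32 + a23) - (a13 - a12) * (a23 - a21)"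
    by (simp add: a \<tau>_def u3 inner_diff_left algebra_simps)
  also have "\<dots> = \<tau>*\<tau> + (\<tau> * (a12 + a32 + a23 + a21 + a31 + a13) + a21 * (a32 + a23) + a31 * (a12 + a32 + a23)
       + a13 * (a12 + a32) + a13 * a21 + a12 * a23)"
    by (simp add: algebra_simps)
  also have "\<dots> > 0"
    using pos by (intro add_pos_nonneg add_nonneg_nonneg mult_pos_pos mult_nonneg_nonneg) auto
  finally show ?thesis .
qed

text \<open>The product is the determinant of the values of \<open>u1\<close>, \<open>u2\<close> at
  \<open>z1 - p\<close>, \<open>z2 - p\<close>. Its off-diagonal entries are \<open>- x\<close> and
  \<open>- y\<close>, and \<open>u1 + u2 + u3 = 0\<close> makes the diagonal entries exceed
  \<open>y\<close> and \<open>x\<close>.\<close>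

lemma cross_about_inner_point:
  fixes u1 u2 u3 z1 z2 p :: complex
  assumes u: "u1 + u2 + u3 = 0" and t: "t1 + t2 + t3 < 0"
    and "u1 \<bullet> z2 \<le> t1" "u2 \<bullet> z1 \<le> t2" "u3 \<bullet> z1 \<le> t3" "u3 \<bullet> z2 \<le> t3"
    and "u1 \<bullet> p > t1" "u2 \<bullet> p > t2" "u3 \<bullet> p > t3"
  shows "cross u1 u2 * cross (z1 - p) (z2 - p) > 0"
proof -
  have u3: "u3 = - u1 - u2"
    using u by (rule third_summand_eq)
  define x y where "x = u1 \<bullet> p - u1 \<bullet> z2" and "y = u2 \<bullet> p - u2 \<bullet> z1"
  have xy: "x > 0" "y > 0" using assms by (auto simp: x_def y_def)
  have "u1 \<bullet> z1 - u1 \<bullet> p > y" "u2 \<bullet> z2 - u2 \<bullet> p > x"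
    using assms by (auto simp: x_def y_def u3 inner_diff_left)
  then have "(u1 \<bullet> z1 - u1 \<bullet> p) * (u2 \<bullet> z2 - u2 \<bullet> p) > y * x"
    using xy by (intro mult_strict_mono) auto
  moreover have "cross u1 u2 * cross (z1 - p) (z2 - p)
      = (u1 \<bullet> z1 - u1 \<bullet> p) * (u2 \<bullet> z2 - u2 \<bullet> p) - (u1 \<bullet> z2 - u1 \<bullet> p) * (u2 \<bullet> z1 - u2 \<bullet> p)"
    by (simp add: cross_def inner_complex_def algebra_simps)
  ultimately show ?thesis
    by (simp add: x_def y_def algebra_simps)
qed

lemma ex_inner_point:
  fixes u1 u2 u3 :: complex
  assumes u: "u1 + u2 + u3 = 0" and t: "t1 + t2 + t3 < (0::real)" and nz: "cross u1 u2 \<noteq> 0"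
  obtains p where "u1 \<bullet> p > t1" "u2 \<bullet> p > t2" "u3 \<bullet> p > t3"
proof -
  define \<tau> where "\<tau> = - (t1 + t2 + t3)"
  have u3: "u3 = - u1 - u2"
    using u by (rule third_summand_eq)
  \<comment> \<open>Cramer's rule for \<open>u1 \<bullet> p = c1\<close> and
    \<open>u2 \<bullet> p = c2\<close>. The deficit \<open>\<tau>\<close> is shared equally, so that
    \<open>u3 \<bullet> p = t3 + \<tau>/3\<close> follows.\<close>
  define c1 c2 where "c1 = t1 + \<tau>/3" and "c2 = t2 + \<tau>/3"
  define p where "p = Complex ((c1 * Im u2 - c2 * Im u1) / cross u1 u2) ((c2 * Re u1 - c1 * Re u2) / cross u1 u2)"
  have "cross u1 u2 * (u1 \<bullet> p) = c1 * cross u1 u2"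
    using nz by (simp add: p_def inner_complex_def distrib_left) (simp add: cross_def algebra_simps)
  then have 1: "u1 \<bullet> p = c1" using nz by simp
  have "cross u1 u2 * (u2 \<bullet> p) = c2 * cross u1 u2"
    using nz by (simp add: p_def inner_complex_def distrib_left) (simp add: cross_def algebra_simps)
  then have 2: "u2 \<bullet> p = c2" using nz by simp
  show ?thesis
    by (rule that[of p]) (use t 1 2 in \<open>auto simp: u3 inner_diff_left c1_def c2_def \<tau>_def field_simps\<close>)
qed

text \<open>Here \<open>p\<close> is interior to the triangle \<open>a b c\<close>: up to scaling,
  \<open>\<alpha>\<close>, \<open>\<beta>\<close>, \<open>\<gamma>\<close> are its barycentric
  coordinates, so the three signed heights have a positive combination equal to zero.\<close>

lemma cross_about_point_sign:
  assumes ab: "cross (a - p) (b - p) > 0" and bc: "cross (b - p) (c - p) > 0" and ca: "cross (c - p) (a - p) > 0"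
    and h: "h \<noteq> 0"
  shows "\<not> (cross h (a - p) \<le> 0 \<and> cross h (b - p) \<le> 0 \<and> cross h (c - p) \<le> 0)"
    and "\<not> (cross h (a - p) \<ge> 0 \<and> cross h (b - p) \<ge> 0 \<and> cross h (c - p) \<ge> 0)"
proof -
  define \<alpha> \<beta> \<gamma> where g: "\<alpha> = cross (b - p) (c - p)" "\<beta> = cross (c - p) (a - p)" "\<gamma> = cross (a - p) (b - p)"
  define x y z where xyz: "x = cross h (a - p)" "y = cross h (b - p)" "z = cross h (c - p)"
  have pos: "\<alpha> > 0" "\<beta> > 0" "\<gamma> > 0" using ab bc ca by (auto simp: g)
  have sum: "\<alpha> * x + \<beta> * y + \<gamma> * z = 0"
    by (simp add: g xyz cross_def algebra_simps)
  have nz: False if "x = 0" "y = 0"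
  proof -
    have "\<gamma> * (h \<bullet> h) = (h \<bullet> (a - p)) * y - (h \<bullet> (b - p)) * x"
      by (simp add: g xyz cross_def inner_complex_def algebra_simps)
    with that pos h show False by simp
  qed
  show "\<not> (cross h (a - p) \<le> 0 \<and> cross h (b - p) \<le> 0 \<and> cross h (c - p) \<le> 0)"
  proof
    assume "cross h (a - p) \<le> 0 \<and> cross h (b - p) \<le> 0 \<and> cross h (c - p) \<le> 0"
    then have "\<alpha> * x \<le> 0" "\<beta> * y \<le> 0" "\<gamma> * z \<le> 0"
      using pos by (auto simp: xyz mult_le_0_iff)
    then have "\<alpha> * x = 0" "\<beta> * y = 0" using sum by linarith+
    then show False using nz pos by auto
  qed
  show "\<not> (cross h (a - p) \<ge> 0 \<and> cross h (b - p) \<ge> 0 \<and> cross h (c - p) \<ge> 0)"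
  proof
    assume "cross h (a - p) \<ge> 0 \<and> cross h (b - p) \<ge> 0 \<and> cross h (c - p) \<ge> 0"
    then have "\<alpha> * x \<ge> 0" "\<beta> * y \<ge> 0" "\<gamma> * z \<ge> 0"
      using pos by (auto simp: xyz)
    then have "\<alpha> * x = 0" "\<beta> * y = 0" using sum by linarith+
    then show False using nz pos by auto
  qed
qed

definition in_wedge :: "(3 \<Rightarrow> complex) \<Rightarrow> (3 \<Rightarrow> real) \<Rightarrow> 3 \<Rightarrow> complex \<Rightarrow> bool" where
  "in_wedge u t i z \<longleftrightarrow> (\<forall>j. j \<noteq> i \<longrightarrow> u j \<bullet> z \<le> t j)"

text \<open>If \<open>u i \<bullet> z \<le> t i\<close> held for all \<open>i\<close>, summing would
  give \<open>0 < 0\<close>. So the open half-planes \<open>u i \<bullet> z > t i\<close> cover the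
  plane, and a point with \<open>in_wedge u t i\<close> lies in the \<open>i\<close>-th one
  only.\<close>

definition half_plane_cover :: "(3 \<Rightarrow> complex) \<Rightarrow> (3 \<Rightarrow> real) \<Rightarrow> bool" where
  "half_plane_cover u t \<longleftrightarrow> (\<Sum>i\<in>UNIV. u i) = 0 \<and> (\<Sum>i\<in>UNIV. t i) < 0"

lemma in_wedge_iff:
  "in_wedge u t 1 z \<longleftrightarrow> u 2 \<bullet> z \<le> t 2 \<and> u 3 \<bullet> z \<le> t 3"
  "in_wedge u t 2 z \<longleftrightarrow> u 1 \<bullet> z \<le> t 1 \<and> u 3 \<bullet> z \<le> t 3"
  "in_wedge u t 3 z \<longleftrightarrow> u 1 \<bullet> z \<le> t 1 \<and> u 2 \<bullet> z \<le> t 2"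
  by (auto simp: in_wedge_def forall_3)

lemma cover_orientation:
  assumes "half_plane_cover u t" "in_wedge u t 1 a" "in_wedge u t 2 b" "in_wedge u t 3 c"
  shows "cross (u 1) (u 2) * cross (a - c) (b - c) > 0"
  using assms by (intro cross_orientation[where ?u3.0 = "u 3" and ?t1.0 = "t 1" and ?t2.0 = "t 2" and ?t3.0 = "t 3"])
    (auto simp: half_plane_cover_def sum_3 in_wedge_iff)

text \<open>The point \<open>p\<close> lies in all three half-planes; rotating the indices in
  \<open>cross_about_inner_point\<close> shows that the wedges surround it in cyclic order.\<close>

lemma cover_inner_point:
  assumes c: "half_plane_cover u t" and k: "cross (u 1) (u 2) > 0"
  obtains p where "\<And>a b. in_wedge u t 1 a \<Longrightarrow> in_wedge u t 2 b \<Longrightarrow> cross (a - p) (b - p) > 0"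
    "\<And>a b. in_wedge u t 2 a \<Longrightarrow> in_wedge u t 3 b \<Longrightarrow> cross (a - p) (b - p) > 0"
    "\<And>a b. in_wedge u t 3 a \<Longrightarrow> in_wedge u t 1 b \<Longrightarrow> cross (a - p) (b - p) > 0"
proof -
  have u: "u 1 + u 2 + u 3 = 0" and t: "t 1 + t 2 + t 3 < 0"
    using c by (auto simp: half_plane_cover_def sum_3)
  have u3: "u 3 = - u 1 - u 2"
    using u by (rule third_summand_eq)
  have k2: "cross (u 2) (u 3) > 0" and k3: "cross (u 3) (u 1) > 0"
    using k by (auto simp: u3 cross_def algebra_simps)
  obtain p where p: "u 1 \<bullet> p > t 1" "u 2 \<bullet> p > t 2" "u 3 \<bullet> p > t 3"
    using ex_inner_point[OF u t] k by auto
  show ?thesis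
  proof (rule that[of p])
    show "cross (a - p) (b - p) > 0" if "in_wedge u t 1 a" "in_wedge u t 2 b" for a b
      using cross_about_inner_point[OF u t, of b a p] that p k by (auto simp: in_wedge_iff zero_less_mult_iff)
    show "cross (a - p) (b - p) > 0" if "in_wedge u t 2 a" "in_wedge u t 3 b" for a b
      using cross_about_inner_point[of "u 2" "u 3" "u 1" "t 2" "t 3" "t 1" b a p] that p k2 u t
      by (auto simp: in_wedge_iff zero_less_mult_iff add_ac)
    show "cross (a - p) (b - p) > 0" if "in_wedge u t 3 a" "in_wedge u t 1 b" for a b
      using cross_about_inner_point[of "u 3" "u 1" "u 2" "t 3" "t 1" "t 2" b a p] that p k3 u t
      by (auto simp: in_wedge_iff zero_less_mult_iff add_ac)
  qed
qed

text \<open>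
  The points \<open>p\<close> and \<open>q\<close> lie in the triangles bounded by the two coverings. The lines
  \<open>y1 y4\<close>, \<open>y5 y2\<close> and \<open>y3 y6\<close> all separate \<open>p\<close> from \<open>q\<close>, which orders the heights \<open>\<eta>\<close> of the \<open>y\<close>'s over
  the line \<open>p q\<close> and contradicts that \<open>p\<close> and \<open>q\<close> lie inside the triangles spanned by transversals.
\<close>

lemma no_rotated_covers:
  assumes cu: "half_plane_cover u t" "cross (u 1) (u 2) > 0" and cw: "half_plane_cover w s" "cross (w 1) (w 2) > 0"
    and y: "in_wedge u t 1 y1" "in_wedge w s 1 y1" "in_wedge u t 1 y2" "in_wedge w s 2 y2"
      "in_wedge u t 2 y3" "in_wedge w s 2 y3" "in_wedge u t 2 y4" "in_wedge w s 3 y4"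
      "in_wedge u t 3 y5" "in_wedge w s 3 y5" "in_wedge u t 3 y6" "in_wedge w s 1 y6"
  shows False
proof -
  obtain p where p: "\<And>a b. in_wedge u t 1 a \<Longrightarrow> in_wedge u t 2 b \<Longrightarrow> cross (a - p) (b - p) > 0"
    "\<And>a b. in_wedge u t 2 a \<Longrightarrow> in_wedge u t 3 b \<Longrightarrow> cross (a - p) (b - p) > 0"
    "\<And>a b. in_wedge u t 3 a \<Longrightarrow> in_wedge u t 1 b \<Longrightarrow> cross (a - p) (b - p) > 0"
    using cover_inner_point[OF cu] by metis
  obtain q where q: "\<And>a b. in_wedge w s 1 a \<Longrightarrow> in_wedge w s 2 b \<Longrightarrow> cross (a - q) (b - q) > 0"
    "\<And>a b. in_wedge w s 2 a \<Longrightarrow> in_wedge w s 3 b \<Longrightarrow> cross (a - q) (b - q) > 0"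
    "\<And>a b. in_wedge w s 3 a \<Longrightarrow> in_wedge w s 1 b \<Longrightarrow> cross (a - q) (b - q) > 0"
    using cover_inner_point[OF cw] by metis
  define h where "h = q - p"
  define \<eta> where "\<eta> x = cross h (x - p)" for x
  have \<eta>q: "cross h (x - q) = \<eta> x" for x
    by (simp add: \<eta>_def h_def cross_def algebra_simps)
  have shift: "\<eta> b - \<eta> a = cross (a - p) (b - p) + cross (b - q) (a - q)" for a b
    by (simp add: \<eta>_def h_def cross_def algebra_simps)
  have 41: "\<eta> y1 < \<eta> y4" and 25: "\<eta> y5 < \<eta> y2" and 63: "\<eta> y3 < \<eta> y6"
    using shift[of y4 y1] p(1)[OF y(1,7)] q(3)[OF y(8,2)]
      shift[of y2 y5] p(3)[OF y(9,3)] q(2)[OF y(4,10)]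
      shift[of y6 y3] p(2)[OF y(5,11)] q(1)[OF y(12,6)] by linarith+
  have h: "h \<noteq> 0" using 41 by (auto simp: \<eta>_def cross_def)
  have row: "\<not> (\<eta> a \<le> 0 \<and> \<eta> b \<le> 0 \<and> \<eta> c \<le> 0)" "\<not> (\<eta> a \<ge> 0 \<and> \<eta> b \<ge> 0 \<and> \<eta> c \<ge> 0)"
    if "in_wedge u t 1 a" "in_wedge u t 2 b" "in_wedge u t 3 c" for a b c
    using cross_about_point_sign[OF p(1)[OF that(1,2)] p(2)[OF that(2,3)] p(3)[OF that(3,1)] h]
    by (auto simp: \<eta>_def)
  have col: "\<not> (\<eta> a \<le> 0 \<and> \<eta> b \<le> 0 \<and> \<eta> c \<le> 0)" "\<not> (\<eta> a \<ge> 0 \<and> \<eta> b \<ge> 0 \<and> \<eta> c \<ge> 0)"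
    if "in_wedge w s 1 a" "in_wedge w s 2 b" "in_wedge w s 3 c" for a b c
    using cross_about_point_sign[OF q(1)[OF that(1,2)] q(2)[OF that(2,3)] q(3)[OF that(3,1)] h]
    by (auto simp: \<eta>q)
  from row(1)[OF y(1) y(5) y(9)] consider "\<eta> y1 > 0" | "\<eta> y3 > 0" | "\<eta> y5 > 0"
    by linarith
  then show False
  proof cases
    case 1
    then show False
      using row(2)[OF y(1) y(7) y(9)] row(2)[OF y(1) y(7) y(11)] col(1)[OF y(12) y(6) y(10)] 41 63 by linarith
  next
    case 2
    then show False
      using row(2)[OF y(1) y(5) y(11)] row(2)[OF y(3) y(5) y(11)] col(1)[OF y(2) y(4) y(10)] 63 25 by linarith
  next
    case 3
    then show False
      using row(2)[OF y(3) y(5) y(9)] row(2)[OF y(3) y(7) y(9)] col(1)[OF y(2) y(6) y(8)] 25 41 by linarith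
  qed
qed

section \<open>Counting points in two coverings\<close>

text \<open>By Frobenius-Koenig, a 3x3 matrix in which every transversal meets a zero has a zero
  row, a zero column or a zero 2x2 block. \<open>hall\<close> excludes all 15 of them, since each
  would force \<open>r \<le> 6*e\<close>.\<close>

lemma matrix_transversal:
  fixes a b c d e' f g h i r e :: nat
  assumes rows: "r \<le> a + b + c + 2*e" "r \<le> d + e' + f + 2*e" "r \<le> g + h + i + 2*e"
    and cols: "a + d + g \<le> r" "b + e' + h \<le> r" "c + f + i \<le> r"
    and r: "r > 20*e"
    and z: "a = 0 \<or> f = 0 \<or> h = 0" "b = 0 \<or> d = 0 \<or> i = 0" "c = 0 \<or> e' = 0 \<or> g = 0"
      "a = 0 \<or> e' = 0 \<or> i = 0" "b = 0 \<or> f = 0 \<or> g = 0" "c = 0 \<or> d = 0 \<or> h = 0"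
  shows False
proof -
  have hall: "\<not> (a = 0 \<and> b = 0 \<and> c = 0)"
    "\<not> (d = 0 \<and> e' = 0 \<and> f = 0)"
    "\<not> (g = 0 \<and> h = 0 \<and> i = 0)"
    "\<not> (a = 0 \<and> d = 0 \<and> g = 0)"
    "\<not> (b = 0 \<and> e' = 0 \<and> h = 0)"
    "\<not> (c = 0 \<and> f = 0 \<and> i = 0)"
    "\<not> (e' = 0 \<and> f = 0 \<and> h = 0 \<and> i = 0)"
    "\<not> (d = 0 \<and> f = 0 \<and> g = 0 \<and> i = 0)"
    "\<not> (d = 0 \<and> e' = 0 \<and> g = 0 \<and> h = 0)"
    "\<not> (b = 0 \<and> c = 0 \<and> h = 0 \<and> i = 0)"
    "\<not> (a = 0 \<and> c = 0 \<and> g = 0 \<and> i = 0)"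
    "\<not> (a = 0 \<and> b = 0 \<and> g = 0 \<and> h = 0)"
    "\<not> (b = 0 \<and> c = 0 \<and> e' = 0 \<and> f = 0)"
    "\<not> (a = 0 \<and> c = 0 \<and> d = 0 \<and> f = 0)"
    "\<not> (a = 0 \<and> b = 0 \<and> d = 0 \<and> e' = 0)"
    using rows cols r by linarith+
  then show False using z by argo
qed

text \<open>By \<open>z\<close> the off-diagonal support has no directed cycle, so the matrix is
  triangular after a simultaneous reordering of rows and columns. The two extreme diagonal entries
  then fill a row or a column up to \<open>2*e\<close>, and the middle one loses at most
  \<open>2*e\<close> more.\<close>

lemma matrix_near_diagonal:
  fixes a b c d e' f g h i r e :: nat
  assumes rows: "r \<le> a + b + c + 2*e" "r \<le> d + e' + f + 2*e" "r \<le> g + h + i + 2*e"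
    "a + b + c \<le> r" "d + e' + f \<le> r" "g + h + i \<le> r"
    and cols: "r \<le> a + d + g + 2*e" "r \<le> b + e' + h + 2*e" "r \<le> c + f + i + 2*e"
    "a + d + g \<le> r" "b + e' + h \<le> r" "c + f + i \<le> r"
    and z: "f = 0 \<or> h = 0" "b = 0 \<or> d = 0" "c = 0 \<or> g = 0"
      "b = 0 \<or> f = 0 \<or> g = 0" "c = 0 \<or> d = 0 \<or> h = 0"
  shows "r \<le> a + 4*e" "r \<le> e' + 4*e" "r \<le> i + 4*e"
  using z by (elim disjE; use rows cols in linarith)+

text \<open>\<open>matrix_transversal\<close> and \<open>odd\<close> leave a positive even
  transversal, and \<open>ev\<close> makes it the only one. A cyclic shift of the columns moves it
  to the diagonal.\<close>

lemma matrix_near_even_permutation: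
  fixes a b c d e' f g h i r e :: nat
  assumes rows: "r \<le> a + b + c + 2*e" "r \<le> d + e' + f + 2*e" "r \<le> g + h + i + 2*e"
    "a + b + c \<le> r" "d + e' + f \<le> r" "g + h + i \<le> r"
    and cols: "r \<le> a + d + g + 2*e" "r \<le> b + e' + h + 2*e" "r \<le> c + f + i + 2*e"
    "a + d + g \<le> r" "b + e' + h \<le> r" "c + f + i \<le> r"
    and odd: "a = 0 \<or> f = 0 \<or> h = 0" "b = 0 \<or> d = 0 \<or> i = 0" "c = 0 \<or> e' = 0 \<or> g = 0"
    and ev: "(a = 0 \<or> e' = 0 \<or> i = 0) \<or> (b = 0 \<or> f = 0 \<or> g = 0)"
      "(b = 0 \<or> f = 0 \<or> g = 0) \<or> (c = 0 \<or> d = 0 \<or> h = 0)"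
      "(c = 0 \<or> d = 0 \<or> h = 0) \<or> (a = 0 \<or> e' = 0 \<or> i = 0)"
    and r: "r > 20*e"
  shows "(r \<le> a + 4*e \<and> r \<le> e' + 4*e \<and> r \<le> i + 4*e) \<or>
         (r \<le> b + 4*e \<and> r \<le> f + 4*e \<and> r \<le> g + 4*e) \<or>
         (r \<le> c + 4*e \<and> r \<le> d + 4*e \<and> r \<le> h + 4*e)"
proof -
  consider "a > 0" "e' > 0" "i > 0" | "b > 0" "f > 0" "g > 0" | "c > 0" "d > 0" "h > 0"
    using matrix_transversal[OF rows(1-3) cols(4-6) r odd] by blast
  then show ?thesis
  proof cases
    case 1
    then show ?thesis
      using matrix_near_diagonal[OF rows cols] odd ev by (intro disjI1) auto
  next
    case 2
    have z: "d = 0 \<or> i = 0" "c = 0 \<or> e' = 0" "a = 0 \<or> h = 0" "c = 0 \<or> d = 0 \<or> h = 0" "a = 0 \<or> e' = 0 \<or> i = 0"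
      using odd ev 2 by auto
    have "r \<le> b + 4*e" "r \<le> f + 4*e" "r \<le> g + 4*e"
      by - (rule matrix_near_diagonal[where a=b and b=c and c=a and d=e' and e'=f and f=d and g=h and h=i and i=g], (rule z | use rows cols in linarith)+)+
    then show ?thesis by blast
  next
    case 3
    have z: "e' = 0 \<or> g = 0" "a = 0 \<or> f = 0" "b = 0 \<or> i = 0" "a = 0 \<or> e' = 0 \<or> i = 0" "b = 0 \<or> f = 0 \<or> g = 0"
      using odd ev 3 by auto
    have "r \<le> c + 4*e" "r \<le> d + 4*e" "r \<le> h + 4*e"
      by - (rule matrix_near_diagonal[where a=c and b=a and c=b and d=f and e'=d and f=e' and g=i and h=g and i=h], (rule z | use rows cols in linarith)+)+
    then show ?thesis by blast
  qed
qed

section \<open>Covers of a finite set by three sets with small overlap\<close>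

definition exclusive :: "(3 \<Rightarrow> 'a set) \<Rightarrow> 3 \<Rightarrow> 'a set" where
  "exclusive A i = A i - (\<Union>j\<in>-{i}. A j)"

lemma exclusive_disjoint: "i \<noteq> j \<Longrightarrow> exclusive A i \<inter> A j = {}"
  by (auto simp: exclusive_def)

lemma exclusive_subset: "exclusive A i \<subseteq> A i"
  by (auto simp: exclusive_def)

text \<open>Double counting: the three cardinalities add up to \<open>card X + e\<close>, and each
  non-exclusive point is counted at least twice.\<close>

lemma card_not_exclusive_le:
  assumes fin: "finite X" and cov: "(\<Union>i. A i) = X" and r: "\<And>i. card (A i) = r" and e: "3*r = card X + e"
  shows "card (X - (\<Union>i. exclusive A i)) \<le> e"
proof -
  let ?D = "X - (\<Union>i. exclusive A i)"
  have sub: "A i \<subseteq> X" for i using cov by blast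
  have m: "(if x \<in> ?D then 2 else 1) \<le> card {i. x \<in> A i}" if x: "x \<in> X" for x
  proof -
    obtain i where i: "x \<in> A i" using x cov by blast
    show ?thesis
    proof (cases "x \<in> ?D")
      case True
      then obtain j where "j \<noteq> i" "x \<in> A j" using i by (auto simp: exclusive_def)
      then have "{i, j} \<subseteq> {i. x \<in> A i}" "card {i, j} = 2" using i by auto
      then show ?thesis using True by (metis card_mono finite)
    next
      case False
      have "{i} \<subseteq> {i. x \<in> A i}" using i by auto
      then have "card {i} \<le> card {i. x \<in> A i}" by (intro card_mono) auto
      then show ?thesis using False by (subst if_not_P) auto
    qed
  qed
  have "card X + card ?D = (\<Sum>x\<in>X. 1) + (\<Sum>x\<in>?D. 1)"
    by simp
  also have "(\<Sum>x\<in>?D. 1::nat) = (\<Sum>x\<in>X. if x \<in> ?D then 1 else 0)"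
    using fin by (intro sum.mono_neutral_cong_left) auto
  also have "(\<Sum>x\<in>X. 1) + (\<Sum>x\<in>X. if x \<in> ?D then 1 else 0) = (\<Sum>x\<in>X. if x \<in> ?D then 2 else (1::nat))"
    unfolding sum.distrib[symmetric] by (intro sum.cong) auto
  also have "\<dots> \<le> (\<Sum>x\<in>X. card {i. x \<in> A i})"
    using m by (rule sum_mono)
  also have "\<dots> = (\<Sum>i\<in>UNIV. card {x\<in>X. x \<in> A i})"
    using sum_multicount_gen[of X UNIV "\<lambda>x i. x \<in> A i"] fin by simp
  also have "\<dots> = (\<Sum>i\<in>(UNIV::3 set). r)"
    using sub r by (intro sum.cong) (auto simp: Int_absorb1 Collect_conj_eq)
  finally show ?thesis using e by simp
qed

definition incidence :: "(3 \<Rightarrow> 'a set) \<Rightarrow> (3 \<Rightarrow> 'a set) \<Rightarrow> 3 \<Rightarrow> 3 \<Rightarrow> nat" where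
  "incidence A B i j = card (exclusive A i \<inter> exclusive B j)"

lemma incidence_commute: "incidence A B i j = incidence B A j i"
  by (simp add: incidence_def Int_commute)

lemma incidence_row_le:
  assumes "finite (A i)"
  shows "(\<Sum>j\<in>UNIV. incidence A B i j) \<le> card (A i)"
proof -
  have "(\<Sum>j\<in>UNIV. incidence A B i j) = card (\<Union>j\<in>UNIV. exclusive A i \<inter> exclusive B j)"
    unfolding incidence_def using assms
    by (intro card_UN_disjoint[symmetric]) (auto simp: exclusive_def)
  also have "\<dots> \<le> card (A i)"
    using assms by (intro card_mono) (auto simp: exclusive_def)
  finally show ?thesis .
qed

text \<open>The points of \<open>A i\<close> missing from the incidences are non-exclusive for
  \<open>A\<close> or for \<open>B\<close>, at most \<open>e\<close> of each kind.\<close>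

lemma incidence_row_ge:
  assumes fin: "finite X" and A: "(\<Union>i. A i) = X" "\<And>i. card (A i) = r"
    and B: "(\<Union>i. B i) = X" "\<And>i. card (B i) = r" and e: "3*r = card X + e"
  shows "r \<le> (\<Sum>j\<in>UNIV. incidence A B i j) + 2*e"
proof -
  have fin': "finite (A i)" "finite (exclusive A i)" for i
    using fin A(1) by (auto intro: finite_subset[of _ X] simp: exclusive_def)
  have "A i \<subseteq> (\<Union>j\<in>UNIV. exclusive A i \<inter> exclusive B j) \<union> ((X - (\<Union>i. exclusive A i)) \<union> (X - (\<Union>i. exclusive B i)))"
  proof
    fix x assume x: "x \<in> A i"
    then have "x \<in> X" using A(1) by auto
    moreover have "k = i" if "x \<in> exclusive A k" for k
      using that x exclusive_disjoint[of k i A] by auto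
    ultimately show "x \<in> (\<Union>j\<in>UNIV. exclusive A i \<inter> exclusive B j) \<union> ((X - (\<Union>i. exclusive A i)) \<union> (X - (\<Union>i. exclusive B i)))"
      by auto
  qed
  then have "r \<le> card ((\<Union>j\<in>UNIV. exclusive A i \<inter> exclusive B j) \<union> ((X - (\<Union>i. exclusive A i)) \<union> (X - (\<Union>i. exclusive B i))))"
    unfolding A(2)[of i, symmetric] using fin fin' by (intro card_mono) auto
  also have "\<dots> \<le> card (\<Union>j\<in>UNIV. exclusive A i \<inter> exclusive B j) + (card (X - (\<Union>i. exclusive A i)) + card (X - (\<Union>i. exclusive B i)))"
    by (intro order_trans[OF card_Un_le] add_left_mono card_Un_le)
  also have "\<dots> \<le> (\<Sum>j\<in>UNIV. incidence A B i j) + (e + e)"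
    unfolding incidence_def
    using card_not_exclusive_le[OF fin A e] card_not_exclusive_le[OF fin B e]
    by (intro add_mono card_UN_le) auto
  finally show ?thesis by simp
qed

text \<open>Half-plane \<open>i\<close> contains points of \<open>A i\<close> only, but not
  necessarily all of them; this allows each \<open>A i\<close> to have exactly \<open>r\<close>
  elements. Later \<open>A i\<close> is the complement of the \<open>k\<close>-set that the
  half-plane avoids.\<close>

definition splits :: "'a set \<Rightarrow> ('a \<Rightarrow> complex) \<Rightarrow> (3 \<Rightarrow> complex) \<Rightarrow> (3 \<Rightarrow> real) \<Rightarrow> (3 \<Rightarrow> 'a set) \<Rightarrow> bool" where
  "splits X z u t A \<longleftrightarrow> half_plane_cover u t \<and> (\<forall>i. \<forall>x\<in>X - A i. u i \<bullet> z x \<le> t i)"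

lemma splits_wedge:
  assumes "splits X z u t A" "x \<in> X" "x \<in> exclusive A i"
  shows "in_wedge u t i (z x)"
  using assms by (auto simp: splits_def exclusive_def in_wedge_def)

lemma incidence_wedge:
  assumes "splits X z u t A" "splits X z w s B" "(\<Union>i. A i) = X" "incidence A B i j \<noteq> 0"
  obtains y where "in_wedge u t i y" "in_wedge w s j y"
proof -
  obtain x where "x \<in> exclusive A i" "x \<in> exclusive B j"
    using assms(4) unfolding incidence_def by (metis card.empty disjoint_iff)
  then show ?thesis
    using that[of "z x"] splits_wedge[OF assms(1)] splits_wedge[OF assms(2)] assms(3) exclusive_subset[of A i] by blast
qed

lemma even_matching:
  assumes fin: "finite X" and A: "(\<Union>i. A i) = X" "\<And>i. card (A i) = r"
    and B: "(\<Union>i. B i) = X" "\<And>i. card (B i) = r" and e: "3*r = card X + e" and r: "r > 20*e"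
    and sA: "splits X z u t A" and sB: "splits X z w s B"
    and cu: "cross (u 1) (u 2) > 0" and cw: "cross (w 1) (w 2) > 0"
  shows "\<exists>p. bij p \<and> (\<forall>i. r \<le> card (A i \<inter> B (p i)) + 4*e)"
proof -
  define M where "M = incidence A B"
  have hu: "half_plane_cover u t" and hw: "half_plane_cover w s" using sA sB by (auto simp: splits_def)
  have w3: "w 3 = - w 1 - w 2"
    using hw third_summand_eq[of "w 1" "w 2" "w 3"] by (simp add: half_plane_cover_def sum_3)
  have cw2: "cross (w 2) (w 3) > 0" and cw3: "cross (w 3) (w 1) > 0"
    using cw by (auto simp: w3 cross_def algebra_simps)
  have finA: "finite (A i)" "finite (B i)" for i
    using fin A(1) B(1) by (metis UN_upper UNIV_I rev_finite_subset)+
  have wedge: "\<exists>y. in_wedge u t i y \<and> in_wedge w s j y" if "M i j \<noteq> 0" for i j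
    using incidence_wedge[OF sA sB A(1)] that unfolding M_def by metis
  have rows: "r \<le> M i 1 + M i 2 + M i 3 + 2*e" "M i 1 + M i 2 + M i 3 \<le> r" for i
    using incidence_row_ge[OF fin A B e, of i] incidence_row_le[of A i B, OF finA(1)] A(2) by (auto simp: M_def sum_3)
  have cols: "r \<le> M 1 i + M 2 i + M 3 i + 2*e" "M 1 i + M 2 i + M 3 i \<le> r" for i
    using incidence_row_ge[OF fin B A e, of i] incidence_row_le[of B i A, OF finA(2)] B(2)
    by (auto simp: M_def sum_3 incidence_commute[of A B])
  \<comment> \<open>Points realising an odd permutation would be positively oriented in two orders
    of opposite parity, once for \<open>u\<close> and once for \<open>w\<close>.\<close>
  have odd1: "M 1 1 = 0 \<or> M 2 3 = 0 \<or> M 3 2 = 0"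
  proof (rule ccontr)
    assume "\<not> ?thesis"
    then obtain a b c where *: "in_wedge u t 1 a" "in_wedge w s 1 a" "in_wedge u t 2 b" "in_wedge w s 3 b"
      "in_wedge u t 3 c" "in_wedge w s 2 c" using wedge by metis
    have "cross (a - c) (b - c) > 0" "cross (a - b) (c - b) > 0"
      using cover_orientation[OF hu *(1,3,5)] cover_orientation[OF hw *(2,6,4)] cu cw
      by (auto simp: zero_less_mult_iff)
    then show False by (simp add: cross_def algebra_simps)
  qed
  have odd2: "M 1 2 = 0 \<or> M 2 1 = 0 \<or> M 3 3 = 0"
  proof (rule ccontr)
    assume "\<not> ?thesis"
    then obtain a b c where *: "in_wedge u t 1 a" "in_wedge w s 2 a" "in_wedge u t 2 b" "in_wedge w s 1 b"
      "in_wedge u t 3 c" "in_wedge w s 3 c" using wedge by metis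
    have "cross (a - c) (b - c) > 0" "cross (b - c) (a - c) > 0"
      using cover_orientation[OF hu *(1,3,5)] cover_orientation[OF hw *(4,2,6)] cu cw
      by (auto simp: zero_less_mult_iff)
    then show False by (simp add: cross_def algebra_simps)
  qed
  have odd3: "M 1 3 = 0 \<or> M 2 2 = 0 \<or> M 3 1 = 0"
  proof (rule ccontr)
    assume "\<not> ?thesis"
    then obtain a b c where *: "in_wedge u t 1 a" "in_wedge w s 3 a" "in_wedge u t 2 b" "in_wedge w s 2 b"
      "in_wedge u t 3 c" "in_wedge w s 1 c" using wedge by metis
    have "cross (a - c) (b - c) > 0" "cross (c - a) (b - a) > 0"
      using cover_orientation[OF hu *(1,3,5)] cover_orientation[OF hw *(6,4,2)] cu cw
      by (auto simp: zero_less_mult_iff)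
    then show False by (simp add: cross_def algebra_simps)
  qed
  \<comment> \<open>Relabelling \<open>w\<close> by a power \<open>q\<close> of the 3-cycle
    \<open>c\<close> turns each pair of even transversals into the one pair that
    \<open>no_rotated_covers\<close> treats.\<close>
  have rot: "\<not> (M 1 (q 1) \<noteq> 0 \<and> M 1 (q 2) \<noteq> 0 \<and> M 2 (q 2) \<noteq> 0 \<and> M 2 (q 3) \<noteq> 0 \<and> M 3 (q 3) \<noteq> 0 \<and> M 3 (q 1) \<noteq> 0)"
    if q: "bij q" "cross (w (q 1)) (w (q 2)) > 0" for q :: "3 \<Rightarrow> 3"
  proof
    assume "M 1 (q 1) \<noteq> 0 \<and> M 1 (q 2) \<noteq> 0 \<and> M 2 (q 2) \<noteq> 0 \<and> M 2 (q 3) \<noteq> 0 \<and> M 3 (q 3) \<noteq> 0 \<and> M 3 (q 1) \<noteq> 0"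
    moreover have "\<exists>y. in_wedge u t i y \<and> in_wedge (w \<circ> q) (s \<circ> q) j y" if m: "M i (q j) \<noteq> 0" for i j
    proof -
      obtain y where y: "in_wedge u t i y" "in_wedge w s (q j) y" using wedge[OF m] by auto
      then have "in_wedge (w \<circ> q) (s \<circ> q) j y"
        using bij_is_inj[OF q(1)] by (auto simp: in_wedge_def inj_eq)
      with y show ?thesis by auto
    qed
    ultimately obtain y1 y2 y3 y4 y5 y6 where
      "in_wedge u t 1 y1" "in_wedge (w \<circ> q) (s \<circ> q) 1 y1" "in_wedge u t 1 y2" "in_wedge (w \<circ> q) (s \<circ> q) 2 y2"
      "in_wedge u t 2 y3" "in_wedge (w \<circ> q) (s \<circ> q) 2 y3" "in_wedge u t 2 y4" "in_wedge (w \<circ> q) (s \<circ> q) 3 y4"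
      "in_wedge u t 3 y5" "in_wedge (w \<circ> q) (s \<circ> q) 3 y5" "in_wedge u t 3 y6" "in_wedge (w \<circ> q) (s \<circ> q) 1 y6"
      by metis
    moreover have "half_plane_cover (w \<circ> q) (s \<circ> q)"
      using hw sum.reindex_bij_betw[of q UNIV UNIV w] sum.reindex_bij_betw[of q UNIV UNIV s] q(1)
      by (simp add: half_plane_cover_def)
    ultimately show False
      using no_rotated_covers[OF hu cu, of "w \<circ> q" "s \<circ> q"] q(2) by (metis comp_apply)
  qed
  define c :: "3 \<Rightarrow> 3" where "c i = (if i = 1 then 2 else if i = 2 then 3 else 1)" for i
  have c: "c 1 = 2" "c 2 = 3" "c 3 = 1" by (auto simp: c_def)
  have bc: "bij c"
    by (rule o_bij[of "\<lambda>i. if i = 1 then 3 else if i = 2 then 1 else 2"]) (auto simp: fun_eq_iff forall_3 c)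
  have bcc: "bij (c \<circ> c)" using bc bc by (rule bij_comp)
  have ev: "(M 1 1 = 0 \<or> M 2 2 = 0 \<or> M 3 3 = 0) \<or> (M 1 2 = 0 \<or> M 2 3 = 0 \<or> M 3 1 = 0)"
    "(M 1 2 = 0 \<or> M 2 3 = 0 \<or> M 3 1 = 0) \<or> (M 1 3 = 0 \<or> M 2 1 = 0 \<or> M 3 2 = 0)"
    "(M 1 3 = 0 \<or> M 2 1 = 0 \<or> M 3 2 = 0) \<or> (M 1 1 = 0 \<or> M 2 2 = 0 \<or> M 3 3 = 0)"
    using rot[of id] rot[OF bc] rot[OF bcc] cw cw2 cw3 by (auto simp: c)
  have le: "r \<le> card (A i \<inter> B j) + 4*e" if "r \<le> M i j + 4*e" for i j
  proof -
    have "M i j \<le> card (A i \<inter> B j)"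
      unfolding M_def incidence_def using finA by (intro card_mono) (auto simp: exclusive_def)
    then show ?thesis using that by simp
  qed
  consider "r \<le> M 1 1 + 4*e \<and> r \<le> M 2 2 + 4*e \<and> r \<le> M 3 3 + 4*e"
    | "r \<le> M 1 2 + 4*e \<and> r \<le> M 2 3 + 4*e \<and> r \<le> M 3 1 + 4*e"
    | "r \<le> M 1 3 + 4*e \<and> r \<le> M 2 1 + 4*e \<and> r \<le> M 3 2 + 4*e"
    using matrix_near_even_permutation[OF rows(1) rows(1) rows(1) rows(2) rows(2) rows(2)
        cols(1) cols(1) cols(1) cols(2) cols(2) cols(2) odd1 odd2 odd3 ev r] by blast
  then show ?thesis
  proof cases
    case 1 then show ?thesis by (intro exI[of _ id]) (auto simp: forall_3 intro: le)
  next
    case 2 then show ?thesis using bc by (intro exI[of _ c]) (auto simp: forall_3 c intro: le)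
  next
    case 3 then show ?thesis using bcc by (intro exI[of _ "c \<circ> c"]) (auto simp: forall_3 c intro: le)
  qed
qed

lemma splits_reindex:
  assumes "splits X z u t A" "bij q"
  shows "splits X z (u \<circ> q) (t \<circ> q) (A \<circ> q)"
  using assms sum.reindex_bij_betw[of q UNIV UNIV u] sum.reindex_bij_betw[of q UNIV UNIV t]
  by (auto simp: splits_def half_plane_cover_def)

text \<open>Every wedge contains a point of \<open>X\<close>, because each \<open>A i\<close> has
  exclusive points; hence the normals are not parallel, and exchanging two labels corrects a
  negative orientation.\<close>

lemma splits_orient:
  assumes fin: "finite X" and A: "(\<Union>i. A i) = X" "\<And>i. card (A i) = r"
    and e: "3*r = card X + e" and r: "r > 20*e" and sA: "splits X z u t A"
  obtains q :: "3 \<Rightarrow> 3" where "bij q" "cross (u (q 1)) (u (q 2)) > 0"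
proof -
  have hu: "half_plane_cover u t" using sA by (auto simp: splits_def)
  have "\<exists>y. in_wedge u t i y" for i
  proof -
    have "(\<Sum>j\<in>UNIV. incidence A A i j) \<noteq> 0"
      using incidence_row_ge[OF fin A A e, of i] r by linarith
    then obtain j where "incidence A A i j \<noteq> 0" by (meson sum.neutral)
    then show ?thesis using incidence_wedge[OF sA sA A(1)] by metis
  qed
  then obtain a b c where *: "in_wedge u t 1 a" "in_wedge u t 2 b" "in_wedge u t 3 c" by metis
  have "cross (u 1) (u 2) \<noteq> 0" using cover_orientation[OF hu *] by auto
  then consider "cross (u 1) (u 2) > 0" | "cross (u 1) (u 2) < 0" by linarith
  then show ?thesis
  proof cases
    case 1 then show ?thesis using that[of id] by auto
  next
    case 2
    define q :: "3 \<Rightarrow> 3" where "q i = (if i = 1 then 2 else if i = 2 then 1 else 3)" for i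
    have "q \<circ> q = id" by (auto simp: fun_eq_iff forall_3 q_def)
    then have "bij q" using o_bij by blast
    then show ?thesis using that[of q] 2 by (auto simp: q_def cross_def algebra_simps)
  qed
qed

lemma matching:
  assumes fin: "finite X" and A: "(\<Union>i. A i) = X" "\<And>i. card (A i) = r"
    and B: "(\<Union>i. B i) = X" "\<And>i. card (B i) = r" and e: "3*r = card X + e" and r: "r > 20*e"
    and sA: "splits X z u t A" and sB: "splits X z w s B"
  obtains p :: "3 \<Rightarrow> 3" where "bij p" "\<And>i. r \<le> card (A i \<inter> B (p i)) + 4*e"
proof -
  obtain f :: "3 \<Rightarrow> 3" where f: "bij f" "cross (u (f 1)) (u (f 2)) > 0" using splits_orient[OF fin A e r sA] by auto
  obtain g :: "3 \<Rightarrow> 3" where g: "bij g" "cross (w (g 1)) (w (g 2)) > 0" using splits_orient[OF fin B e r sB] by auto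
  have "(\<Union>i. (A \<circ> f) i) = X" "(\<Union>i. (B \<circ> g) i) = X"
    using A(1) B(1) bij_is_surj[OF f(1)] bij_is_surj[OF g(1)] by (metis image_comp)+
  then obtain p :: "3 \<Rightarrow> 3" where p: "bij p" "\<And>i. r \<le> card (A (f i) \<inter> B (g (p i))) + 4*e"
    using even_matching[of X "A \<circ> f" r "B \<circ> g" e z "u \<circ> f" "t \<circ> f" "w \<circ> g" "s \<circ> g"]
      fin A(2) B(2) e r f g splits_reindex[OF sA f(1)] splits_reindex[OF sB g(1)] by auto
  show ?thesis
  proof (rule that[of "g \<circ> p \<circ> inv f"])
    show "bij (g \<circ> p \<circ> inv f)" using f(1) g(1) p(1) by (intro bij_comp bij_imp_bij_inv) auto
    show "r \<le> card (A i \<inter> B ((g \<circ> p \<circ> inv f) i)) + 4*e" for i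
      using p(2)[of "inv f i"] bij_is_surj[OF f(1)] by (simp add: surj_f_inv_f)
  qed
qed

lemma card_Int_le_overlap:
  assumes fin: "finite X" and A: "(\<Union>i. A i) = X" "\<And>i. card (A i) = r"
    and e: "3*r = card X + e" and ij: "(i::3) \<noteq> j"
  shows "card (A i \<inter> A j) \<le> e"
proof -
  have "A i \<inter> A j \<subseteq> X - (\<Union>i. exclusive A i)"
  proof
    fix x assume x: "x \<in> A i \<inter> A j"
    have "x \<notin> exclusive A k" for k
      using x ij exclusive_disjoint[of k i A] exclusive_disjoint[of k j A] by (cases "k = i") auto
    then show "x \<in> X - (\<Union>i. exclusive A i)" using x A(1) by blast
  qed
  then have "card (A i \<inter> A j) \<le> card (X - (\<Union>i. exclusive A i))" using fin by (intro card_mono) auto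
  also have "\<dots> \<le> e" by (rule card_not_exclusive_le[OF fin A e])
  finally show ?thesis .
qed

text \<open>Any threshold between two well separated ranges would do: for \<open>r > 20*e\<close>,
  matched classes overlap in at least \<open>r - 4*e\<close> points and unmatched ones in at most
  \<open>5*e\<close>.\<close>

definition similar :: "'a set \<Rightarrow> 'a set \<Rightarrow> bool" where
  "similar A B \<longleftrightarrow> card A < 2 * card (A \<inter> B)"

lemma similar_matching:
  assumes fin: "finite X" and A: "(\<Union>i. A i) = X" "\<And>i. card (A i) = r"
    and B: "(\<Union>i. B i) = X" "\<And>i. card (B i) = r" and e: "3*r = card X + e" and r: "r > 20*e"
    and sA: "splits X z u t A" and sB: "splits X z w s B"
  obtains p :: "3 \<Rightarrow> 3" where "bij p" "\<And>i j. similar (A i) (B j) \<longleftrightarrow> j = p i"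
    "\<And>i j. similar (A i) (B j) \<Longrightarrow> r \<le> card (A i \<inter> B j) + 4*e"
proof -
  obtain p :: "3 \<Rightarrow> 3" where p: "bij p" "\<And>i. r \<le> card (A i \<inter> B (p i)) + 4*e"
    using matching[OF assms] by metis
  have fin': "finite (A i)" "finite (B i)" for i
    using fin A(1) B(1) by (metis UN_upper UNIV_I rev_finite_subset)+
  have sim: "similar (A i) (B j) \<longleftrightarrow> j = p i" for i j
  proof
    assume "j = p i"
    then show "similar (A i) (B j)" using p(2)[of i] r A(2)[of i] by (simp add: similar_def)
  next
    assume s: "similar (A i) (B j)"
    show "j = p i"
    proof (rule ccontr)
      assume "j \<noteq> p i"
      then have "card (B j \<inter> B (p i)) \<le> e" by (rule card_Int_le_overlap[OF fin B e])
      moreover have "card (A i \<inter> B j) + card (A i \<inter> B (p i)) = card ((A i \<inter> B j) \<union> (A i \<inter> B (p i))) + card ((A i \<inter> B j) \<inter> (A i \<inter> B (p i)))"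
        using fin' by (intro card_Un_Int) auto
      moreover have "card ((A i \<inter> B j) \<union> (A i \<inter> B (p i))) \<le> card (A i)"
        using fin' by (intro card_mono) auto
      moreover have "card ((A i \<inter> B j) \<inter> (A i \<inter> B (p i))) \<le> card (B j \<inter> B (p i))"
        using fin' by (intro card_mono) auto
      ultimately show False using s p(2)[of i] r A(2)[of i] by (simp add: similar_def)
    qed
  qed
  show ?thesis
    by (rule that[OF p(1) sim]) (use p(2) sim in auto)
qed

section \<open>Charts for the tangent bundle of the sphere\<close>

text \<open>
  In terms of continuous logarithms of \<open>f\<close> and \<open>g\<close>, the gluing condition would give a continuous
  logarithm of \<open>- z ^ 6\<close> on the unit circle.
\<close>

lemma no_glued_discs:
  fixes f g :: "complex \<Rightarrow> complex"
  assumes f: "continuous_on (cball 0 1) f" "\<And>z. z \<in> cball 0 1 \<Longrightarrow> f z \<noteq> 0"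
    and g: "continuous_on (cball 0 1) g" "\<And>z. z \<in> cball 0 1 \<Longrightarrow> g z \<noteq> 0"
    and glue: "\<And>z. norm z = 1 \<Longrightarrow> g z = - (z ^ 6) * cnj (f z)"
  shows False
proof -
  obtain a where a: "continuous_on (cball 0 1) a" "\<And>z. z \<in> cball 0 1 \<Longrightarrow> f z = exp (a z)"
    using continuous_logarithm_on_cball[OF f] by blast
  obtain b where b: "continuous_on (cball 0 1) b" "\<And>z. z \<in> cball 0 1 \<Longrightarrow> g z = exp (b z)"
    using continuous_logarithm_on_cball[OF g] by blast
  define h where "h t = b (cis t) - cnj (a (cis t)) - 6 * \<i> * complex_of_real t" for t
  have exp_h: "exp (h t) = -1" for t
  proof -
    have "exp (b (cis t)) = - (cis t ^ 6) * cnj (exp (a (cis t)))"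
      using glue[of "cis t"] a(2)[of "cis t"] b(2)[of "cis t"] by simp
    moreover have "exp (6 * \<i> * complex_of_real t) = cis t ^ 6"
      by (simp add: cis_conv_exp mult_ac flip: exp_of_nat_mult)
    ultimately show ?thesis
      by (simp add: h_def exp_diff exp_cnj)
  qed
  have "continuous_on {0..2*pi} h"
    unfolding h_def
    by (intro continuous_intros continuous_on_compose2[OF a(1)] continuous_on_compose2[OF b(1)]) auto
  moreover have "\<exists>e>0. \<forall>y. y \<in> {0..2*pi} \<and> h y \<noteq> h x \<longrightarrow> e \<le> norm (h y - h x)" for x
  proof (intro exI[of _ "2*pi"] conjI allI impI)
    fix y assume y: "y \<in> {0..2*pi} \<and> h y \<noteq> h x"
    have "exp (h y) = exp (h x)" by (simp add: exp_h)
    then obtain n :: int where n: "h y = h x + (of_int (2*n) * pi) * \<i>" by (auto simp: exp_eq)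
    with y have "n \<noteq> 0" by auto
    then have "\<bar>real_of_int n\<bar> \<ge> 1" by linarith
    moreover have "norm (h y - h x) = 2 * \<bar>real_of_int n\<bar> * pi"
      by (simp add: n norm_mult abs_mult)
    ultimately show "2*pi \<le> norm (h y - h x)" by simp
  qed simp
  ultimately have "h constant_on {0..2*pi}"
    by (intro continuous_discrete_range_constant) (auto intro: connected_Icc)
  then have "h 0 = h (2*pi)"
    by (auto simp: constant_on_def)
  then show False by (auto simp: h_def complex_eq_iff)
qed

text \<open>
  For \<open>s = \<plusminus>1\<close> and a unit vector \<open>v\<close> with \<open>s * snd v \<ge> 0\<close>, the map \<open>chart s v\<close> consists of the first two
  coordinates after the rotation that takes \<open>v\<close> to the pole \<open>(0, s)\<close> along a great circle; it has kernel
  spanned by \<open>v\<close> and is an isometry on the tangent plane. Its adjoint is \<open>unchart s v\<close>.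
\<close>

definition chart :: "real \<Rightarrow> complex \<times> real \<Rightarrow> complex \<times> real \<Rightarrow> complex" where
  "chart s v x = fst x - ((fst v \<bullet> fst x) / (1 + s * snd v) + s * snd x) *\<^sub>R fst v"

definition unchart :: "real \<Rightarrow> complex \<times> real \<Rightarrow> complex \<Rightarrow> complex \<times> real" where
  "unchart s v w = (w - ((w \<bullet> fst v) / (1 + s * snd v)) *\<^sub>R fst v, - s * (w \<bullet> fst v))"

definition in_chart :: "real \<Rightarrow> complex \<times> real \<Rightarrow> bool" where
  "in_chart s v \<longleftrightarrow> s * s = 1 \<and> v \<bullet> v = 1 \<and> s * snd v \<ge> 0"

lemma linear_chart: "linear (chart s v)"
  by (rule linearI) (simp_all add: chart_def algebra_simps inner_add_right add_divide_distrib)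

lemma linear_unchart: "linear (unchart s v)"
  by (rule linearI) (simp_all add: unchart_def algebra_simps inner_add_left add_divide_distrib)

lemma inner_unchart: "unchart s v w \<bullet> x = w \<bullet> chart s v x"
  by (simp add: unchart_def chart_def inner_prod_def inner_diff_left inner_diff_right algebra_simps)

lemma chart_self:
  assumes "in_chart s v"
  shows "chart s v v = 0"
proof -
  have s: "s * s = 1" and p: "1 + s * snd v \<noteq> 0" using assms by (auto simp: in_chart_def)
  have "fst v \<bullet> fst v = 1 - snd v * snd v" using assms by (simp add: in_chart_def inner_prod_def)
  also have "\<dots> = (1 + s * snd v) * (1 - s * snd v)"
    using s by (simp add: algebra_simps)
  finally have "(fst v \<bullet> fst v) / (1 + s * snd v) = 1 - s * snd v" using p by simp
  then show ?thesis by (simp add: chart_def)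
qed

lemma unchart_orthogonal:
  assumes "in_chart s v"
  shows "unchart s v w \<bullet> v = 0"
  by (simp add: inner_unchart chart_self[OF assms])

lemma unchart_eq_0:
  assumes "in_chart s v" "unchart s v w = 0"
  shows "w = 0"
proof -
  have "s \<noteq> 0" using assms by (auto simp: in_chart_def)
  then have "w \<bullet> fst v = 0" using assms by (auto simp: unchart_def prod_eq_iff)
  then show ?thesis using assms by (auto simp: unchart_def prod_eq_iff)
qed

text \<open>Since \<open>unchart\<close> is the adjoint of \<open>chart\<close>, this left inverse
  makes \<open>chart\<close> an isometry on the tangent plane.\<close>

lemma unchart_chart:
  assumes "in_chart s v" "u \<bullet> v = 0"
  shows "unchart s v (chart s v u) = u"
proof -
  have s: "s * s = 1" and p: "1 + s * snd v \<noteq> 0" using assms by (auto simp: in_chart_def)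
  have vv: "fst v \<bullet> fst v = 1 - snd v * snd v" using assms by (simp add: in_chart_def inner_prod_def)
  have uv: "fst v \<bullet> fst u = - snd u * snd v" using assms(2) by (simp add: inner_prod_def inner_commute algebra_simps)
  have c: "(fst v \<bullet> fst u) / (1 + s * snd v) + s * snd u = s * snd u / (1 + s * snd v)"
    using p s by (simp add: uv field_simps)
  have d: "chart s v u = fst u - (s * snd u / (1 + s * snd v)) *\<^sub>R fst v"
    by (simp add: chart_def c)
  have "chart s v u \<bullet> fst v = - snd u * snd v - (s * snd u / (1 + s * snd v)) * ((1 + s * snd v) * (1 - s * snd v))"
    using s by (simp add: d inner_diff_left uv[unfolded inner_commute[of "fst v"]] vv algebra_simps)
  also have "\<dots> = - snd u * snd v - s * snd u * (1 - s * snd v)"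
    using p by simp
  also have "\<dots> = (s * s - 1) * (snd u * snd v) - s * snd u"
    by (simp add: algebra_simps)
  also have "\<dots> = - s * snd u"
    using s by simp
  finally have e: "chart s v u \<bullet> fst v = - s * snd u" .
  show ?thesis
    unfolding unchart_def e using s by (simp add: d prod_eq_iff flip: mult.assoc)
qed

lemma inner_chart:
  assumes "in_chart s v" "u \<bullet> v = 0"
  shows "u \<bullet> x = chart s v u \<bullet> chart s v x"
  using inner_unchart[of s v "chart s v u" x] unchart_chart[OF assms] by simp

text \<open>On the equator \<open>fst u = \<i> * y * fst v\<close> with \<open>y\<close> real, so
  \<open>chart s v u = (\<i> * y - s * snd u) * fst v\<close>, and conjugation exchanges the two
  charts up to the stated factor. Its degree 2 is the Euler number of the tangent bundle; the
  conjugation appears because the charts have opposite orientations.\<close>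

lemma chart_equator:
  assumes "snd v = 0" "v \<bullet> v = 1" "u \<bullet> v = 0"
  shows "chart (-1) v u = - ((fst v)^2) * cnj (chart 1 v u)"
proof -
  define a b where "a = Re (fst v)" and "b = Im (fst v)"
  define x y where "x = Re (fst u)" and "y = Im (fst u)"
  have n: "a*a + b*b = 1" and o: "x*a + y*b = 0"
    using assms by (auto simp: a_def b_def x_def y_def inner_prod_def inner_complex_def)
  have fv: "fst v = Complex a b" and fu: "fst u = Complex x y" by (auto simp: a_def b_def x_def y_def)
  have vu: "fst v \<bullet> fst u = 0" using o by (simp add: fv fu inner_complex_def mult.commute)
  have fv2: "fst v * cnj (fst v) = 1" using n by (simp add: fv complex_eq_iff)
  have "fst v * cnj (fst u) + cnj (fst v) * fst u = 0"
    using o by (simp add: fv fu complex_eq_iff algebra_simps)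
  then have "fst v * (fst v * cnj (fst u)) + (fst v * cnj (fst v)) * fst u = 0"
    by (metis distrib_left mult.assoc mult_zero_right)
  then have k: "fst v * (fst v * cnj (fst u)) = - fst u"
    by (simp add: fv2 add_eq_0_iff2)
  have "- ((fst v)^2) * cnj (chart 1 v u) = - (fst v * (fst v * cnj (fst u))) + of_real (snd u) * (fst v * (fst v * cnj (fst v)))"
    using assms(1) by (simp add: chart_def vu scaleR_conv_of_real power2_eq_square algebra_simps)
  also have "\<dots> = chart (-1) v u"
    using assms(1) by (simp add: k fv2 chart_def vu scaleR_conv_of_real)
  finally show ?thesis by simp
qed

definition disc_point :: "real \<Rightarrow> complex \<Rightarrow> complex \<times> real" where
  "disc_point s z = (z, s * sqrt (1 - (norm z)^2))"

lemma in_chart_disc_point: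
  assumes "s * s = 1" "norm z \<le> 1"
  shows "in_chart s (disc_point s z)"
proof -
  have "(norm z)^2 \<le> 1" using assms(2) by (simp add: abs_square_le_1)
  then show ?thesis
    using assms(1)
    by (simp add: in_chart_def disc_point_def inner_prod_def power2_norm_eq_inner mult_ac flip: mult.assoc)
qed

lemma disc_point_equator: "norm z = 1 \<Longrightarrow> disc_point s z = (z, 0)"
  by (simp add: disc_point_def)

lemma continuous_on_disc_point: "continuous_on S (disc_point s)"
  unfolding disc_point_def by (intro continuous_intros)

lemma continuous_on_chart:
  assumes s: "s * s = 1" and f: "continuous_on (cball 0 1) f"
  shows "continuous_on (cball 0 1) (\<lambda>z. chart s (disc_point s z) (f z))"
proof -
  have "1 + s * snd (disc_point s z) \<noteq> 0" if "z \<in> cball 0 1" for z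
    using in_chart_disc_point[OF s, of z] that by (auto simp: in_chart_def)
  then show ?thesis
    unfolding chart_def by (intro continuous_intros f continuous_on_disc_point) auto
qed

section \<open>Separating triples\<close>

lemma Helly_complex:
  fixes F :: "complex set set"
  assumes fin: "finite F" and ne: "F \<noteq> {}" and conv: "\<And>K. K \<in> F \<Longrightarrow> convex K"
    and meet: "\<And>A B C. A \<in> F \<Longrightarrow> B \<in> F \<Longrightarrow> C \<in> F \<Longrightarrow> A \<inter> B \<inter> C \<noteq> {}"
  shows "\<Inter>F \<noteq> {}"
proof (cases "card F \<ge> 3")
  case True
  have meet3: "\<Inter>T \<noteq> {}" if T: "T \<subseteq> F" "card T = 3" for T
  proof -
    obtain A B C where "T = {A, B, C}" using T(2) by (auto simp: card_3_iff)
    then show ?thesis using meet[of A B C] T(1) by (auto simp: Int_assoc)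
  qed
  show ?thesis
  proof (rule Helly)
    show "card F \<ge> DIM(complex) + 1" using True by simp
    show "\<forall>K\<in>F. convex K" using conv by blast
    show "\<Inter>T \<noteq> {}" if "T \<subseteq> F" "card T = DIM(complex) + 1" for T
      using meet3[of T] that by simp
  qed
next
  case False
  have "card F \<noteq> 0" using fin ne by simp
  with False consider "card F = 1" | "card F = 2" by linarith
  then show ?thesis
  proof cases
    case 1
    then obtain A where "F = {A}" by (auto simp: card_1_singleton_iff)
    then show ?thesis using meet[of A A A] by auto
  next
    case 2
    then obtain A B where "F = {A, B}" by (auto simp: card_2_iff)
    then show ?thesis using meet[of A A B] by auto
  qed
qed

text \<open>The three sets have no common point iff 0 is not of the form
  \<open>(x1 - x3, x2 - x3)\<close>. A functional separating this compact convex image from 0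
  supplies two of the normals, and the differences force the third.\<close>

lemma separation_of_three:
  fixes K1 K2 K3 :: "complex set"
  assumes K: "compact K1" "compact K2" "compact K3" "convex K1" "convex K2" "convex K3"
    and disj: "K1 \<inter> K2 \<inter> K3 = {}"
  obtains u1 u2 u3 where "u1 + u2 + u3 = 0"
    "\<And>x1 x2 x3. x1 \<in> K1 \<Longrightarrow> x2 \<in> K2 \<Longrightarrow> x3 \<in> K3 \<Longrightarrow> u1 \<bullet> x1 + u2 \<bullet> x2 + u3 \<bullet> x3 < 0"
proof -
  define T :: "complex \<times> complex \<times> complex \<Rightarrow> complex \<times> complex" where
    "T x = (fst x - snd (snd x), fst (snd x) - snd (snd x))" for x
  have T: "linear T" by (rule linearI) (auto simp: T_def algebra_simps)
  let ?K = "T ` (K1 \<times> (K2 \<times> K3))"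
  have cv: "convex ?K" using K T by (intro convex_linear_image convex_Times)
  have "compact ?K"
    using K T by (intro compact_continuous_image compact_Times linear_continuous_on) (auto simp: linear_conv_bounded_linear)
  then have cl: "closed ?K" by (rule compact_imp_closed)
  have nz: "0 \<notin> ?K" using disj by (auto simp: T_def zero_prod_def)
  obtain a b where ab: "0 < b" "\<And>x. x \<in> ?K \<Longrightarrow> a \<bullet> x > b"
    using separating_hyperplane_closed_0[OF cv cl nz] by metis
  show ?thesis
  proof (rule that[of "- fst a" "- snd a" "fst a + snd a"])
    fix x1 x2 x3 assume "x1 \<in> K1" "x2 \<in> K2" "x3 \<in> K3"
    then have "T (x1, x2, x3) \<in> ?K" by auto
    then have "a \<bullet> T (x1, x2, x3) > 0" using ab by fastforce
    then show "- fst a \<bullet> x1 + - snd a \<bullet> x2 + (fst a + snd a) \<bullet> x3 < 0"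
      by (simp add: T_def inner_prod_def algebra_simps)
  qed simp
qed

text \<open>The thresholds \<open>t\<close> are eliminated. What remains for finite \<open>S\<close>
  is a finite system of strict inequalities, which is stable under perturbation and has the same
  form in space and in every chart.\<close>

definition separating :: "('a \<Rightarrow> 'e::real_inner) \<Rightarrow> (3 \<Rightarrow> 'a set) \<Rightarrow> (3 \<Rightarrow> 'e) \<Rightarrow> bool" where
  "separating P S u \<longleftrightarrow> (\<Sum>i\<in>UNIV. u i) = 0 \<and> (\<forall>x\<in>Pi UNIV S. (\<Sum>i\<in>UNIV. u i \<bullet> P (x i)) < 0)"

lemma no_common_point_imp_separating:
  fixes z :: "'a \<Rightarrow> complex"
  assumes fin: "finite X" and no: "\<And>q. \<exists>S\<subseteq>X. card S = k \<and> q \<notin> convex hull (z ` S)"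
  obtains S w where "\<And>i. S i \<subseteq> X" "\<And>i. card (S i) = k" "separating z S w"
proof -
  let ?F = "(\<lambda>S. convex hull (z ` S)) ` {S. S \<subseteq> X \<and> card S = k}"
  have "finite ?F" using fin by simp
  moreover have "?F \<noteq> {}" using no by blast
  moreover have "\<Inter>?F = {}" using no by blast
  ultimately obtain A B C where ABC: "A \<in> ?F" "B \<in> ?F" "C \<in> ?F" "A \<inter> B \<inter> C = {}"
    using Helly_complex[of ?F] convex_convex_hull by blast
  obtain S1 S2 S3 where S: "A = convex hull (z ` S1)" "B = convex hull (z ` S2)" "C = convex hull (z ` S3)"
    "S1 \<subseteq> X" "S2 \<subseteq> X" "S3 \<subseteq> X" "card S1 = k" "card S2 = k" "card S3 = k"
    using ABC(1-3) by auto
  have cpt: "compact (convex hull (z ` T))" if "T \<subseteq> X" for T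
    using that fin by (intro compact_convex_hull finite_imp_compact finite_imageI) (auto intro: finite_subset)
  obtain u1 u2 u3 where u: "u1 + u2 + u3 = 0"
    "\<And>x1 x2 x3. x1 \<in> A \<Longrightarrow> x2 \<in> B \<Longrightarrow> x3 \<in> C \<Longrightarrow> u1 \<bullet> x1 + u2 \<bullet> x2 + u3 \<bullet> x3 < 0"
    using separation_of_three[of A B C] ABC(4) cpt S by (metis convex_convex_hull)
  let ?S = "\<lambda>i::3. if i = 1 then S1 else if i = 2 then S2 else S3"
  let ?w = "\<lambda>i::3. if i = 1 then u1 else if i = 2 then u2 else u3"
  show ?thesis
  proof (rule that[of ?S ?w])
    show "separating z ?S ?w"
      unfolding separating_def
    proof (intro conjI ballI)
      fix x assume "x \<in> Pi UNIV ?S"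
      then have "x 1 \<in> S1" "x 2 \<in> S2" "x 3 \<in> S3" by (auto simp: Pi_def forall_3)
      then have "z (x 1) \<in> A" "z (x 2) \<in> B" "z (x 3) \<in> C" using S by (auto intro: hull_inc)
      then show "(\<Sum>i\<in>UNIV. ?w i \<bullet> z (x i)) < 0" using u(2) by (simp add: sum_3)
    qed (use u(1) in \<open>simp add: sum_3\<close>)
  qed (use S in auto)
qed

text \<open>The maxima \<open>t i\<close> are attained at points \<open>x i\<close> that together
  form one member of \<open>Pi UNIV S\<close>; the inequality for it says that the
  \<open>t i\<close> have negative sum.\<close>

lemma separating_imp_splits:
  fixes z :: "'a \<Rightarrow> complex"
  assumes separating: "separating z S u" and fin: "\<And>i. finite (S i)" and ne: "\<And>i. S i \<noteq> {}"
  obtains t where "splits X z u t (\<lambda>i. X - S i)"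
proof -
  define t where "t i = Max ((\<lambda>x. u i \<bullet> z x) ` S i)" for i
  have "t i \<in> (\<lambda>x. u i \<bullet> z x) ` S i" for i
    unfolding t_def using fin ne by (intro Max_in) auto
  then have "\<exists>x. x \<in> S i \<and> t i = u i \<bullet> z x" for i by auto
  then obtain x where x: "\<And>i. x i \<in> S i" "\<And>i. t i = u i \<bullet> z (x i)" by metis
  have "half_plane_cover u t"
    using separating x by (auto simp: half_plane_cover_def separating_def)
  moreover have "u i \<bullet> z y \<le> t i" if "y \<in> S i" for i y
    unfolding t_def using that fin by (intro Max_ge) auto
  ultimately show ?thesis by (intro that) (auto simp: splits_def)
qed

text \<open>A point in all three \<open>S i\<close> could be chosen three times, and zero sum of the
  normals would give \<open>0 < 0\<close>.\<close>

lemma separating_imp_cover: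
  assumes "separating z S u"
  shows "(\<Union>i. X - S i) = X"
proof -
  have False if "\<And>i. x \<in> S i" for x
  proof -
    have "(\<Sum>i\<in>UNIV. u i \<bullet> z x) < 0" using assms that by (auto simp: separating_def)
    then show False using assms by (simp add: separating_def flip: inner_sum_left)
  qed
  then show ?thesis by blast
qed

section \<open>Nonvanishing of the class averages and of their product\<close>

lemma card_Int_transfer:
  assumes fin: "finite A" and "card A = r" and "r \<le> card (A \<inter> B) + a" "r \<le> card (A \<inter> C) + b"
  shows "r \<le> card (B \<inter> A \<inter> C) + a + b"
proof -
  have "card (A \<inter> B) + card (A \<inter> C) = card ((A \<inter> B) \<union> (A \<inter> C)) + card ((A \<inter> B) \<inter> (A \<inter> C))"
    using fin by (intro card_Un_Int) auto
  moreover have "card ((A \<inter> B) \<union> (A \<inter> C)) \<le> card A"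
    using fin by (intro card_mono) auto
  moreover have "(A \<inter> B) \<inter> (A \<inter> C) = B \<inter> A \<inter> C" by auto
  ultimately show ?thesis using assms by simp
qed

text \<open>Each of at most three sets misses at most \<open>5*e\<close> points of \<open>A\<close>
  exclusively and has at most \<open>4*e\<close> points outside \<open>A\<close>. So some
  \<open>y\<close> is exclusive to all of them and some \<open>x\<close> lies in none; the other two
  normals at \<open>y\<close> and the zero sum push \<open>\<tau> \<bullet> z y\<close> above the
  threshold, and \<open>d\<close> is the difference of the images.\<close>

lemma common_positive_direction:
  fixes z :: "'a \<Rightarrow> complex"
  assumes fin: "finite X" and e: "3*r = card X + e" and r: "r > 20*e"
    and A: "A \<subseteq> X" "card A = r"
    and T: "finite T" "card T \<le> 3"
    and B: "\<And>\<tau>. \<tau> \<in> T \<Longrightarrow> \<exists>u t B i. \<tau> = u i \<and> splits X z u t B \<and> (\<Union>i. B i) = X \<and> (\<forall>i. card (B i) = r) \<and> r \<le> card (A \<inter> B i) + 4*e"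
  shows "\<exists>d. \<forall>\<tau>\<in>T. \<tau> \<bullet> d > 0"
proof -
  obtain u t B i where B: "\<And>\<tau>. \<tau> \<in> T \<Longrightarrow> \<tau> = u \<tau> (i \<tau>) \<and> splits X z (u \<tau>) (t \<tau>) (B \<tau>) \<and> (\<Union>i. B \<tau> i) = X
      \<and> (\<forall>i. card (B \<tau> i) = r) \<and> r \<le> card (A \<inter> B \<tau> (i \<tau>)) + 4*e"
    using B by metis
  have finA: "finite A" using A fin finite_subset by auto
  have finB: "finite (B \<tau> j)" if "\<tau> \<in> T" for \<tau> j
    using fin B[OF that] by (metis UN_upper UNIV_I rev_finite_subset)
  have diff: "card (A - exclusive (B \<tau>) (i \<tau>)) \<le> 5*e" if \<tau>: "\<tau> \<in> T" for \<tau>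
  proof -
    have B': "(\<Union>i. B \<tau> i) = X" "\<And>i. card (B \<tau> i) = r" using B[OF \<tau>] by auto
    have "A - exclusive (B \<tau>) (i \<tau>) \<subseteq> (A - B \<tau> (i \<tau>)) \<union> (X - (\<Union>i. exclusive (B \<tau>) i))"
    proof
      fix x assume x: "x \<in> A - exclusive (B \<tau>) (i \<tau>)"
      have "k = i \<tau>" if "x \<in> B \<tau> (i \<tau>)" "x \<in> exclusive (B \<tau>) k" for k
        using that exclusive_disjoint[of k "i \<tau>" "B \<tau>"] by auto
      then show "x \<in> (A - B \<tau> (i \<tau>)) \<union> (X - (\<Union>i. exclusive (B \<tau>) i))" using x A(1) by auto
    qed
    then have "card (A - exclusive (B \<tau>) (i \<tau>)) \<le> card ((A - B \<tau> (i \<tau>)) \<union> (X - (\<Union>i. exclusive (B \<tau>) i)))"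
      using finA fin by (intro card_mono) auto
    also have "\<dots> \<le> card (A - B \<tau> (i \<tau>)) + card (X - (\<Union>i. exclusive (B \<tau>) i))" by (rule card_Un_le)
    also have "card (A - B \<tau> (i \<tau>)) = r - card (A \<inter> B \<tau> (i \<tau>))"
      using finA A by (simp add: card_Diff_subset_Int)
    also have "card (X - (\<Union>i. exclusive (B \<tau>) i)) \<le> e" by (rule card_not_exclusive_le[OF fin B' e])
    finally show ?thesis using B[OF \<tau>] by linarith
  qed
  have diff': "card (B \<tau> (i \<tau>) - A) \<le> 4*e" if \<tau>: "\<tau> \<in> T" for \<tau>
  proof -
    have "card (B \<tau> (i \<tau>) - A) = r - card (A \<inter> B \<tau> (i \<tau>))"
      using finB[OF \<tau>] B[OF \<tau>] by (simp add: card_Diff_subset_Int Int_commute)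
    then show ?thesis using B[OF \<tau>] by linarith
  qed
  have "\<exists>y\<in>A. \<forall>\<tau>\<in>T. y \<in> exclusive (B \<tau>) (i \<tau>)"
  proof (rule ccontr)
    assume "\<not> ?thesis"
    then have "A \<subseteq> (\<Union>\<tau>\<in>T. A - exclusive (B \<tau>) (i \<tau>))" by blast
    then have "card A \<le> card (\<Union>\<tau>\<in>T. A - exclusive (B \<tau>) (i \<tau>))" using T finA by (intro card_mono) auto
    also have "\<dots> \<le> (\<Sum>\<tau>\<in>T. card (A - exclusive (B \<tau>) (i \<tau>)))" using T by (intro card_UN_le) auto
    also have "\<dots> \<le> (\<Sum>\<tau>\<in>T. 5*e)" by (intro sum_mono diff)
    also have "\<dots> \<le> 3 * (5*e)" using T(2) by simp
    finally show False using A r by simp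
  qed
  then obtain y where y: "y \<in> A" "\<And>\<tau>. \<tau> \<in> T \<Longrightarrow> y \<in> exclusive (B \<tau>) (i \<tau>)" by auto
  have "\<exists>x\<in>X. \<forall>\<tau>\<in>T. x \<notin> B \<tau> (i \<tau>)"
  proof (rule ccontr)
    assume "\<not> ?thesis"
    then have "X \<subseteq> A \<union> (\<Union>\<tau>\<in>T. B \<tau> (i \<tau>) - A)" by blast
    then have "card X \<le> card (A \<union> (\<Union>\<tau>\<in>T. B \<tau> (i \<tau>) - A))" using T finA finB by (intro card_mono) auto
    also have "\<dots> \<le> card A + card (\<Union>\<tau>\<in>T. B \<tau> (i \<tau>) - A)" by (rule card_Un_le)
    also have "card (\<Union>\<tau>\<in>T. B \<tau> (i \<tau>) - A) \<le> (\<Sum>\<tau>\<in>T. card (B \<tau> (i \<tau>) - A))" using T by (intro card_UN_le) auto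
    also have "\<dots> \<le> (\<Sum>\<tau>\<in>T. 4*e)" by (intro sum_mono diff')
    also have "\<dots> \<le> 3 * (4*e)" using T(2) by simp
    finally show False using A r e by simp
  qed
  then obtain x where x: "x \<in> X" "\<And>\<tau>. \<tau> \<in> T \<Longrightarrow> x \<notin> B \<tau> (i \<tau>)" by auto
  have "\<tau> \<bullet> (z y - z x) > 0" if \<tau>: "\<tau> \<in> T" for \<tau>
  proof -
    have sp: "splits X z (u \<tau>) (t \<tau>) (B \<tau>)" and ui: "\<tau> = u \<tau> (i \<tau>)" using B[OF \<tau>] by auto
    have "u \<tau> (i \<tau>) \<bullet> z x \<le> t \<tau> (i \<tau>)" using sp x \<tau> by (auto simp: splits_def)
    moreover have "in_wedge (u \<tau>) (t \<tau>) (i \<tau>) (z y)"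
      using sp y \<tau> A by (intro splits_wedge[OF sp]) auto
    then have "(\<Sum>j\<in>-{i \<tau>}. u \<tau> j \<bullet> z y) \<le> (\<Sum>j\<in>-{i \<tau>}. t \<tau> j)"
      by (intro sum_mono) (auto simp: in_wedge_def)
    moreover have "(\<Sum>j\<in>UNIV. u \<tau> j \<bullet> z y) = 0" "(\<Sum>j\<in>UNIV. t \<tau> j) < 0"
      using sp by (auto simp: splits_def half_plane_cover_def simp flip: inner_sum_left)
    moreover have "(\<Sum>j\<in>UNIV. f j) = f (i \<tau>) + (\<Sum>j\<in>-{i \<tau>}. f j)" for f :: "3 \<Rightarrow> real"
      by (subst sum.remove[of UNIV "i \<tau>"]) (auto simp: Compl_eq_Diff_UNIV)
    ultimately show ?thesis by (subst ui) (simp add: inner_diff_right)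
  qed
  then show ?thesis by blast
qed

text \<open>Caratheodory's theorem in the plane reduces the claim that 0 is not in the hull to at
  most three vectors; separation from 0 then gives one direction that is positive on all of
  them.\<close>

lemma positive_combination_nonzero:
  fixes u :: "'i \<Rightarrow> complex"
  assumes fin: "finite I" and ne: "I \<noteq> {}" and pos: "\<And>i. i \<in> I \<Longrightarrow> c i > 0"
    and dir: "\<And>T. finite T \<Longrightarrow> T \<subseteq> u ` I \<Longrightarrow> card T \<le> 3 \<Longrightarrow> \<exists>d. \<forall>\<tau>\<in>T. \<tau> \<bullet> d > 0"
  shows "(\<Sum>i\<in>I. c i *\<^sub>R u i) \<noteq> 0"
proof -
  have nz: "0 \<notin> convex hull (u ` I)"
  proof
    assume "0 \<in> convex hull (u ` I)"
    then obtain T where T: "finite T" "T \<subseteq> u ` I" "card T \<le> 3" "0 \<in> convex hull T"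
      unfolding caratheodory[of "u ` I"] by auto
    then obtain d where d: "\<forall>\<tau>\<in>T. \<tau> \<bullet> d > 0" using dir by metis
    have "convex hull T \<subseteq> {x. d \<bullet> x > 0}"
      using d by (intro hull_minimal convex_halfspace_gt) (auto simp: inner_commute)
    with T(4) show False by auto
  qed
  have cl: "closed (convex hull (u ` I))"
    using fin by (intro compact_imp_closed compact_convex_hull finite_imp_compact) auto
  obtain a b where ab: "0 < b" "\<And>x. x \<in> convex hull (u ` I) \<Longrightarrow> a \<bullet> x > b"
    using separating_hyperplane_closed_0[OF convex_convex_hull cl nz] by metis
  have "a \<bullet> u i > 0" if "i \<in> I" for i
    using ab(2)[of "u i"] ab(1) that by (simp add: hull_inc)
  then have "(\<Sum>i\<in>I. c i * (a \<bullet> u i)) > 0"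
    using fin ne pos by (intro sum_pos) auto
  then have "a \<bullet> (\<Sum>i\<in>I. c i *\<^sub>R u i) > 0" by (simp add: inner_sum_right)
  then show ?thesis by auto
qed

text \<open>
  The sum collects the normals of all half-planes in the class of \<open>A\<close>, over all triples \<open>h\<close>; multiplying
  over the three classes makes the result independent of the labelling of the classes.
\<close>

definition class_sum :: "'a set \<Rightarrow> ('g \<Rightarrow> 3 \<Rightarrow> 'a set) \<Rightarrow> 'g set \<Rightarrow> ('g \<Rightarrow> real) \<Rightarrow> ('g \<Rightarrow> 3 \<Rightarrow> complex) \<Rightarrow> 'a set \<Rightarrow> complex" where
  "class_sum X S G \<gamma> u A = (\<Sum>h\<in>G. \<Sum>j\<in>UNIV. if similar A (X - S h j) then \<gamma> h *\<^sub>R u h j else 0)"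

definition class_product :: "'a set \<Rightarrow> ('g \<Rightarrow> 3 \<Rightarrow> 'a set) \<Rightarrow> 'g set \<Rightarrow> ('g \<Rightarrow> real) \<Rightarrow> ('g \<Rightarrow> 3 \<Rightarrow> complex) \<Rightarrow> complex" where
  "class_product X S G \<gamma> u = (\<Sum>g\<in>G. \<gamma> g *\<^sub>R (\<Prod>i\<in>UNIV. class_sum X S G \<gamma> u (X - S g i)))"

text \<open>All \<open>g\<close> of positive weight give the same product of class sums, so the
  outer sum is that product times the total weight. Summing over \<open>g\<close> avoids selecting
  one, which could not be done continuously.\<close>

lemma class_product_nonzero:
  fixes z :: "'a \<Rightarrow> complex"
  assumes fin: "finite X" and e: "3*r = card X + e" and r: "r > 20*e"
    and S: "\<And>g i. g \<in> G \<Longrightarrow> S g i \<subseteq> X" "\<And>g i. g \<in> G \<Longrightarrow> card (X - S g i) = r" "\<And>g i. g \<in> G \<Longrightarrow> S g i \<noteq> {}"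
    and G: "finite G" and \<gamma>: "\<And>g. g \<in> G \<Longrightarrow> \<gamma> g \<ge> 0" "\<exists>g\<in>G. \<gamma> g > 0"
    and separating: "\<And>g. g \<in> G \<Longrightarrow> \<gamma> g > 0 \<Longrightarrow> separating z (S g) (u g)"
  shows "class_product X S G \<gamma> u \<noteq> 0"
proof -
  define Q where "Q g i = class_sum X S G \<gamma> u (X - S g i)" for g i
  define H where "H = {g\<in>G. \<gamma> g > 0}"
  have H: "finite H" "\<And>h. h \<in> H \<Longrightarrow> h \<in> G" "\<And>h. h \<in> H \<Longrightarrow> \<gamma> h > 0" using G by (auto simp: H_def)
  have out: "\<gamma> g = 0" if "g \<in> G" "g \<notin> H" for g using that \<gamma>(1)[of g] by (auto simp: H_def)
  have cov: "(\<Union>i. X - S h i) = X" if "h \<in> H" for h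
    using separating_imp_cover[OF separating] that by (auto simp: H_def)
  have crd: "card (X - S h i) = r" if "h \<in> H" for h i using that S(2) H(2) by auto
  have "\<exists>t. splits X z (u h) t (\<lambda>i. X - S h i)" if h: "h \<in> H" for h
  proof -
    have "finite (S h i)" for i using S(1)[OF H(2)[OF h]] fin finite_subset by blast
    then show ?thesis using separating_imp_splits[OF separating[OF H(2)[OF h] H(3)[OF h]]] S(3)[OF H(2)[OF h]] by metis
  qed
  then obtain t where t: "\<And>h. h \<in> H \<Longrightarrow> splits X z (u h) (t h) (\<lambda>i. X - S h i)" by metis
  have QH: "Q g i = (\<Sum>(h,j)\<in>{(h,j). h \<in> H \<and> similar (X - S g i) (X - S h j)}. \<gamma> h *\<^sub>R u h j)" for g i
  proof -
    have "Q g i = (\<Sum>h\<in>H. \<Sum>j\<in>UNIV. if similar (X - S g i) (X - S h j) then \<gamma> h *\<^sub>R u h j else 0)"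
      unfolding Q_def class_sum_def using out G H(2)
      by (intro sum.mono_neutral_right) (auto intro!: sum.neutral)
    also have "\<dots> = (\<Sum>(h,j)\<in>H \<times> UNIV. if similar (X - S g i) (X - S h j) then \<gamma> h *\<^sub>R u h j else 0)"
      by (simp add: sum.cartesian_product)
    also have "\<dots> = (\<Sum>(h,j)\<in>{(h,j). h \<in> H \<and> similar (X - S g i) (X - S h j)}. \<gamma> h *\<^sub>R u h j)"
      using H(1) by (intro sum.mono_neutral_cong_right) (auto split: if_splits)
    finally show ?thesis .
  qed
  have match: "\<exists>p. bij p \<and> (\<forall>i j. similar (X - S g i) (X - S h j) \<longleftrightarrow> j = p i) \<and>
      (\<forall>i j. similar (X - S g i) (X - S h j) \<longrightarrow> r \<le> card ((X - S g i) \<inter> (X - S h j)) + 4*e)"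
    if "g \<in> H" "h \<in> H" for g h
    using similar_matching[OF fin cov[OF that(1)] crd[OF that(1)] cov[OF that(2)] crd[OF that(2)] e r t[OF that(1)] t[OF that(2)]]
    by metis
  have Qnz: "Q g i \<noteq> 0" if g: "g \<in> H" for g i
  proof -
    let ?I = "{(h,j). h \<in> H \<and> similar (X - S g i) (X - S h j)}"
    have "(\<Sum>q\<in>?I. \<gamma> (fst q) *\<^sub>R u (fst q) (snd q)) \<noteq> 0"
    proof (rule positive_combination_nonzero)
      have "?I \<subseteq> H \<times> UNIV" by auto
      then show "finite ?I" by (rule finite_subset) (use H(1) in simp)
      have "similar (X - S g i) (X - S g i)" using crd[OF g] r by (simp add: similar_def)
      then show "?I \<noteq> {}" using g by auto
      show "\<gamma> (fst q) > 0" if "q \<in> ?I" for q using that H(3) by auto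
      show "\<exists>d. \<forall>\<tau>\<in>T. \<tau> \<bullet> d > 0"
        if T: "finite T" "T \<subseteq> (\<lambda>q. u (fst q) (snd q)) ` ?I" "card T \<le> 3" for T
      proof (rule common_positive_direction[OF fin e r _ crd[OF g] T(1,3)])
        fix \<tau> assume "\<tau> \<in> T"
        then obtain h j where hj: "h \<in> H" "similar (X - S g i) (X - S h j)" "\<tau> = u h j" using T(2) by auto
        have "r \<le> card ((X - S g i) \<inter> (X - S h j)) + 4*e" using match[OF g hj(1)] hj(2) by blast
        then show "\<exists>u t B k. \<tau> = u k \<and> splits X z u t B \<and> (\<Union>i. B i) = X \<and> (\<forall>i. card (B i) = r)
            \<and> r \<le> card ((X - S g i) \<inter> B k) + 4*e"
          using hj(3) t[OF hj(1)] cov[OF hj(1)] crd[OF hj(1)]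
          by (intro exI[of _ "u h"] exI[of _ "t h"] exI[of _ "\<lambda>i. X - S h i"] exI[of _ j] conjI allI)
      qed auto
    qed
    then show ?thesis by (simp add: QH split_def)
  qed
  \<comment> \<open>Similarity is transitive here: two overlaps cost \<open>4*e\<close> each, and
    \<open>r - 8*e\<close> is still more than half of \<open>r\<close>.\<close>
  have Qeq: "Q g i = Q g' i'" if g: "g \<in> H" "g' \<in> H" and sim: "similar (X - S g i) (X - S g' i')" for g g' i i'
  proof -
    have fin': "finite (X - S g j)" for g j using fin by auto
    have "similar (X - S g i) (X - S h j) \<longleftrightarrow> similar (X - S g' i') (X - S h j)" if h: "h \<in> H" for h j
    proof -
      have gg: "r \<le> card ((X - S g i) \<inter> (X - S g' i')) + 4*e" using match[OF g] sim by blast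
      show ?thesis
      proof
        assume "similar (X - S g i) (X - S h j)"
        then have "r \<le> card ((X - S g i) \<inter> (X - S h j)) + 4*e" using match[OF g(1) h] by blast
        from card_Int_transfer[OF fin' crd[OF g(1)] gg this]
        have "r \<le> card ((X - S g' i') \<inter> (X - S g i) \<inter> (X - S h j)) + 8*e" by simp
        also have "card ((X - S g' i') \<inter> (X - S g i) \<inter> (X - S h j)) \<le> card ((X - S g' i') \<inter> (X - S h j))"
          using fin by (intro card_mono) auto
        finally show "similar (X - S g' i') (X - S h j)" using r crd[OF g(2)] by (simp add: similar_def)
      next
        assume "similar (X - S g' i') (X - S h j)"
        then have *: "r \<le> card ((X - S g' i') \<inter> (X - S h j)) + 4*e" using match[OF g(2) h] by blast
        have "r \<le> card ((X - S g' i') \<inter> (X - S g i)) + 4*e" using gg by (simp add: Int_commute)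
        from card_Int_transfer[OF fin' crd[OF g(2)] this *]
        have "r \<le> card ((X - S g i) \<inter> (X - S g' i') \<inter> (X - S h j)) + 8*e" by simp
        also have "card ((X - S g i) \<inter> (X - S g' i') \<inter> (X - S h j)) \<le> card ((X - S g i) \<inter> (X - S h j))"
          using fin by (intro card_mono) auto
        finally show "similar (X - S g i) (X - S h j)" using r crd[OF g(1)] by (simp add: similar_def)
      qed
    qed
    then show ?thesis by (auto simp: QH intro!: sum.cong)
  qed
  have prodeq: "(\<Prod>i\<in>UNIV. Q g i) = (\<Prod>i\<in>UNIV. Q g' i)" if g: "g \<in> H" "g' \<in> H" for g g'
  proof -
    obtain p where p: "bij p" "\<And>i. similar (X - S g i) (X - S g' (p i))" using match[OF g] by metis
    have "(\<Prod>i\<in>UNIV. Q g i) = (\<Prod>i\<in>UNIV. Q g' (p i))" using Qeq[OF g p(2)] by simp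
    also have "\<dots> = (\<Prod>i\<in>UNIV. Q g' i)" using p(1) by (rule prod.reindex_bij_betw)
    finally show ?thesis .
  qed
  obtain g0 where g0: "g0 \<in> H" using \<gamma>(2) by (auto simp: H_def)
  have "class_product X S G \<gamma> u = (\<Sum>g\<in>H. \<gamma> g *\<^sub>R (\<Prod>i\<in>UNIV. Q g i))"
    unfolding class_product_def Q_def using out G H(2) by (intro sum.mono_neutral_right) auto
  also have "\<dots> = (\<Sum>g\<in>H. \<gamma> g *\<^sub>R (\<Prod>i\<in>UNIV. Q g0 i))"
    using prodeq[OF _ g0] by (intro sum.cong) auto
  also have "\<dots> = (\<Sum>g\<in>H. \<gamma> g) *\<^sub>R (\<Prod>i\<in>UNIV. Q g0 i)"
    by (simp add: scaleR_left.sum)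
  also have "\<dots> \<noteq> 0"
  proof -
    have "(\<Sum>g\<in>H. \<gamma> g) > 0" using H g0 by (intro sum_pos) auto
    then show ?thesis using Qnz[OF g0] by simp
  qed
  finally show ?thesis .
qed

section \<open>Line transversals in space\<close>

lemma class_sum_cnj:
  "class_sum X S G \<gamma> (\<lambda>g i. c * cnj (u g i)) A = c * cnj (class_sum X S G \<gamma> u A)"
  unfolding class_sum_def cnj_sum sum_distrib_left
  by (intro sum.cong refl) (auto simp: scaleR_conv_of_real)

text \<open>Similarity and the real weights do not involve \<open>u\<close>, so only the three
  factors transform. The cube is the third tensor power.\<close>

lemma class_product_cnj:
  "class_product X S G \<gamma> (\<lambda>g i. c * cnj (u g i)) = c ^ 3 * cnj (class_product X S G \<gamma> u)"
  unfolding class_product_def class_sum_cnj cnj_sum sum_distrib_left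
  by (intro sum.cong refl) (simp add: scaleR_conv_of_real prod.distrib)

lemma continuous_on_class_product:
  assumes "\<And>g. g \<in> G \<Longrightarrow> continuous_on T (\<lambda>z. \<gamma> z g)" "\<And>g i. g \<in> G \<Longrightarrow> continuous_on T (\<lambda>z. u z g i)"
  shows "continuous_on T (\<lambda>z. class_product X S G (\<gamma> z) (u z))"
proof -
  have "continuous_on T (\<lambda>z. if b then \<gamma> z g *\<^sub>R u z g i else 0)" if "g \<in> G" for b g i
    using assms that by (cases b) (auto intro!: continuous_intros)
  then show ?thesis
    unfolding class_product_def class_sum_def by (intro continuous_intros assms)
qed

definition tangent :: "'e::real_inner \<Rightarrow> 'e \<Rightarrow> 'e" where
  "tangent v u = u - (u \<bullet> v) *\<^sub>R v"

lemma tangent_orthogonal: "v \<bullet> v = 1 \<Longrightarrow> tangent v u \<bullet> v = 0"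
  by (simp add: tangent_def inner_diff_left)

lemma tangent_id: "u \<bullet> v = 0 \<Longrightarrow> tangent v u = u"
  by (simp add: tangent_def)

lemma sum_tangent: "(\<Sum>i\<in>I. tangent v (u i)) = tangent v (\<Sum>i\<in>I. u i)"
  by (simp add: tangent_def sum_subtractf inner_sum_left scaleR_left.sum)

lemma continuous_on_tangent [continuous_intros]:
  "continuous_on T f \<Longrightarrow> continuous_on T (\<lambda>x. tangent (f x) u)"
  unfolding tangent_def by (intro continuous_intros)

text \<open>
  The weights replace a partition of unity: they are continuous in \<open>v\<close> and positive exactly where
  the tangential parts of \<open>u\<close> still separate the three sets.
\<close>

definition weight :: "('a \<Rightarrow> 'e::real_inner) \<Rightarrow> (3 \<Rightarrow> 'a set) \<Rightarrow> (3 \<Rightarrow> 'e) \<Rightarrow> 'e \<Rightarrow> real" where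
  "weight P S u v = (\<Prod>x\<in>Pi UNIV S. max 0 (- (\<Sum>i\<in>UNIV. tangent v (u i) \<bullet> P (x i))))"

lemma weight_nonneg: "weight P S u v \<ge> 0"
  unfolding weight_def by (intro prod_nonneg) auto

lemma continuous_on_weight:
  "continuous_on T f \<Longrightarrow> continuous_on T (\<lambda>x. weight P S u (f x))"
  unfolding weight_def by (intro continuous_intros)

lemma finite_Pi_UNIV:
  assumes "\<And>i::3. finite (S i)"
  shows "finite (Pi UNIV S)"
  using finite_PiE[of UNIV S] assms by (simp add: PiE_UNIV_domain)

lemma weight_pos_iff:
  assumes "\<And>i. finite (S i)" "(\<Sum>i\<in>UNIV. u i) = 0"
  shows "weight P S u v > 0 \<longleftrightarrow> separating P S (\<lambda>i. tangent v (u i))"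
proof -
  have "weight P S u v > 0 \<longleftrightarrow> weight P S u v \<noteq> 0" using weight_nonneg[of P S u v] by linarith
  also have "\<dots> \<longleftrightarrow> (\<forall>x\<in>Pi UNIV S. (\<Sum>i\<in>UNIV. tangent v (u i) \<bullet> P (x i)) < 0)"
    using finite_Pi_UNIV[of S] assms(1) by (auto simp: weight_def max_def)
  also have "\<dots> \<longleftrightarrow> separating P S (\<lambda>i. tangent v (u i))"
    using assms(2) by (simp add: separating_def sum_tangent) (simp add: tangent_def)
  finally show ?thesis .
qed

lemma separating_chart:
  assumes v: "in_chart s v" and b: "separating P S u" and o: "\<And>i. u i \<bullet> v = 0"
  shows "separating (\<lambda>x. chart s v (P x)) S (\<lambda>i. chart s v (u i))"
  using b inner_chart[OF v o]
  by (simp add: separating_def flip: linear_sum[OF linear_chart]) (simp add: linear_0[OF linear_chart])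

lemma separating_unchart:
  assumes "separating (\<lambda>x. chart s v (P x)) S w"
  shows "separating P S (\<lambda>i. unchart s v (w i))"
  using assms
  by (simp add: separating_def inner_unchart flip: linear_sum[OF linear_unchart]) (simp add: linear_0[OF linear_unchart])

text \<open>The preimage of \<open>q\<close> under \<open>chart s v\<close> is a line of direction
  \<open>v\<close>, so a common point of the projected hulls is a line meeting all the hulls in
  space.\<close>

theorem line_transversal_in_chart:
  fixes P :: "'a \<Rightarrow> complex \<times> real"
  assumes fin: "finite X" and e: "3*r = card X + e" and r: "r > 20*e" and k: "k + r = card X" "k \<ge> 1"
  obtains s v q where "in_chart s v" "\<And>S. S \<subseteq> X \<Longrightarrow> card S = k \<Longrightarrow> q \<in> convex hull ((\<lambda>x. chart s v (P x)) ` S)"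
proof -
  have "\<exists>s v q. in_chart s v \<and> (\<forall>S. S \<subseteq> X \<longrightarrow> card S = k \<longrightarrow> q \<in> convex hull ((\<lambda>x. chart s v (P x)) ` S))"
  proof (rule ccontr)
    assume "\<not> ?thesis"
    then have no: "\<exists>S\<subseteq>X. card S = k \<and> q \<notin> convex hull ((\<lambda>x. chart s v (P x)) ` S)" if "in_chart s v" for s v q
      using that by blast
    define A :: "((3 \<Rightarrow> 'a set) \<times> (3 \<Rightarrow> complex \<times> real)) set" where "A = {(S, u). (\<forall>i. S i \<subseteq> X \<and> card (S i) = k) \<and> (\<Sum>i\<in>UNIV. u i) = (0::complex \<times> real)}"
    define W where "W g = {v. weight P (fst g) (snd g) v > 0}" for g
    have finS: "finite (fst g i)" if "g \<in> A" for g i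
      using that finite_subset[OF _ fin] by (auto simp: A_def)
    have openW: "open (W g)" for g
      unfolding W_def
      by (intro open_Collect_less continuous_on_const continuous_on_weight continuous_on_id)
    have cover: "sphere 0 1 \<subseteq> (\<Union>g\<in>A. W g)"
    proof
      fix v :: "complex \<times> real" assume "v \<in> sphere 0 1"
      then have vv: "v \<bullet> v = 1" by (simp add: norm_eq_1)
      define s :: real where "s = (if snd v \<ge> 0 then 1 else -1)"
      have sv: "in_chart s v" using vv by (auto simp: in_chart_def s_def)
      obtain S w where S: "\<And>i. S i \<subseteq> X" "\<And>i. card (S i) = k" and b: "separating (\<lambda>x. chart s v (P x)) S w"
        using no_common_point_imp_separating[OF fin no[OF sv]] by metis
      let ?u = "\<lambda>i. unchart s v (w i)"
      have bu: "separating P S ?u" by (rule separating_unchart[OF b])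
      have g: "(S, ?u) \<in> A" using S bu by (auto simp: A_def separating_def)
      \<comment> \<open>At the point \<open>v\<close> itself the chosen vectors are already tangent,
        so their weight is positive there; the projection only matters at nearby points.\<close>
      have "(\<lambda>i. tangent v (?u i)) = ?u"
        using unchart_orthogonal[OF sv] by (simp add: tangent_id)
      then have "weight P S ?u v > 0"
        using weight_pos_iff[of S ?u P v] finS[OF g] g bu by (auto simp: A_def)
      then show "v \<in> (\<Union>g\<in>A. W g)" using g unfolding W_def by force
    qed
    \<comment> \<open>Compactness leaves finitely many triples, so that the class sums are finite
      and continuous.\<close>
    obtain G where G: "G \<subseteq> A" "finite G" "sphere 0 1 \<subseteq> (\<Union>g\<in>G. W g)"
      using compactE_image[OF compact_sphere, of A W 0 1] openW cover by blast
    define F where "F s z = class_product X fst G (\<lambda>g. weight P (fst g) (snd g) (disc_point s z))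
        (\<lambda>g i. chart s (disc_point s z) (tangent (disc_point s z) (snd g i)))" for s z
    have Fcont: "continuous_on (cball 0 1) (F s)" if "s * s = 1" for s
      unfolding F_def
      by (intro continuous_on_class_product continuous_on_weight continuous_on_chart[OF that]
          continuous_on_tangent continuous_on_disc_point)
    have Fnz: "F s z \<noteq> 0" if s: "s * s = 1" "z \<in> cball 0 1" for s z
    proof -
      define v where "v = disc_point s z"
      have sv: "in_chart s v" unfolding v_def using s by (intro in_chart_disc_point) auto
      then have vv: "v \<bullet> v = 1" by (auto simp: in_chart_def)
      have "class_product X fst G (\<lambda>g. weight P (fst g) (snd g) v) (\<lambda>g i. chart s v (tangent v (snd g i))) \<noteq> 0"
      proof (rule class_product_nonzero[OF fin e r, where z = "\<lambda>x. chart s v (P x)"])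
        fix g assume g: "g \<in> G"
        then have gA: "g \<in> A" using G by auto
        have gS: "fst g i \<subseteq> X" "card (fst g i) = k" for i using gA by (simp_all add: A_def mem_Times_iff)
        show "fst g i \<subseteq> X" for i by (rule gS)
        show "card (X - fst g i) = r" for i
          using gS[of i] k fin finS[OF gA] by (simp add: card_Diff_subset)
        show "fst g i \<noteq> {}" for i using gS(2)[of i] k by auto
        show "0 \<le> weight P (fst g) (snd g) v" by (rule weight_nonneg)
        assume "0 < weight P (fst g) (snd g) v"
        then have "separating P (fst g) (\<lambda>i. tangent v (snd g i))"
          using weight_pos_iff[of "fst g" "snd g" P v] finS[OF gA] gA by (auto simp: A_def)
        then show "separating (\<lambda>x. chart s v (P x)) (fst g) (\<lambda>i. chart s v (tangent v (snd g i)))"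
          by (rule separating_chart[OF sv]) (rule tangent_orthogonal[OF vv])
      next
        have "v \<in> sphere 0 1" using vv by (simp add: norm_eq_1)
        then show "\<exists>g\<in>G. 0 < weight P (fst g) (snd g) v" using G(3) by (auto simp: W_def)
      qed (rule G(2))
      then show ?thesis by (simp add: F_def v_def)
    qed
    have glue: "F (-1) z = - (z ^ 6) * cnj (F 1 z)" if z: "norm z = 1" for z
    proof -
      let ?v = "(z, 0::real)"
      have vv: "?v \<bullet> ?v = 1" using z by (simp add: inner_prod_def norm_eq_1)
      have "chart (-1) ?v (tangent ?v u) = - (z^2) * cnj (chart 1 ?v (tangent ?v u))" for u
        using chart_equator[OF _ vv tangent_orthogonal[OF vv]] by simp
      \<comment> \<open>Each normal changes by the factor \<open>- (z^2)\<close> and a conjugation;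
        the weights depend only on the point of the sphere, hence agree in both charts.\<close>
      then have "F (-1) z = (- (z^2)) ^ 3 * cnj (F 1 z)"
        unfolding F_def disc_point_equator[OF z] by (simp only: class_product_cnj)
      then show ?thesis by (simp flip: power_mult)
    qed
    show False
      by (rule no_glued_discs[of "F 1" "F (-1)"]) (use Fcont Fnz glue in auto)
  qed
  then show ?thesis using that by blast
qed

section \<open>Transversals of codimension two\<close>

lemma kneser_transversal_hyperplane:
  fixes T :: "'e::euclidean_space set"
  assumes T: "kneser_transversal k l X T" and l: "l \<ge> 1" and fin: "finite X"
  obtains a b where "a \<noteq> 0" "card {x\<in>X. a \<bullet> x < b} < k" "card {x\<in>X. a \<bullet> x > b} < k"
proof -
  have "aff_dim T < DIM('e)" using T l by (auto simp: kneser_transversal_def)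
  then obtain a b where a: "a \<noteq> 0" "T \<subseteq> {x. a \<bullet> x = b}"
    using aff_lowdim_subset_hyperplane by metis
  \<comment> \<open>With \<open>k\<close> points in a convex set missing \<open>T\<close>, their
    hull would miss \<open>T\<close>.\<close>
  have *: "card {x\<in>X. x \<in> H} < k" if H: "convex H" "H \<inter> T = {}" for H
  proof (rule ccontr)
    assume "\<not> ?thesis"
    then obtain S where S: "S \<subseteq> {x\<in>X. x \<in> H}" "card S = k"
      by (metis linorder_not_less obtain_subset_with_card_n)
    then have "T \<inter> convex hull S \<noteq> {}" using T by (auto simp: kneser_transversal_def)
    moreover have "convex hull S \<subseteq> H" using S H by (intro hull_minimal) auto
    ultimately show False using H by auto
  qed
  show ?thesis
    using that[OF a(1), of b] *[of "{x. a \<bullet> x < b}"] *[of "{x. a \<bullet> x > b}"] a(2)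
    by (auto simp: convex_halfspace_lt convex_halfspace_gt disjoint_iff)
qed

text \<open>Along the moment curve the equation of a hyperplane is a polynomial of degree at most
  the dimension, and it is not the zero polynomial because \<open>a \<noteq> 0\<close> supplies a
  coefficient.\<close>

lemma moment_curve_hyperplane:
  fixes idx :: "'n::finite \<Rightarrow> nat" and a :: "real ^ 'n"
  assumes idx: "bij_betw idx UNIV {1..CARD('n)}" and a: "a \<noteq> 0"
  shows "card {t. a \<bullet> (\<chi> i. t ^ idx i) = b} \<le> CARD('n)" "finite {t. a \<bullet> (\<chi> i. t ^ idx i) = b}"
proof -
  define c where "c j = (if j = 0 then - b else a $ the_inv_into UNIV idx j)" for j
  have inj: "inj idx" and img: "range idx = {1..CARD('n)}" using idx by (auto simp: bij_betw_def)
  have ci: "c (idx i) = a $ i" for i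
  proof -
    have "idx i \<noteq> 0" using img by (metis atLeastAtMost_iff not_one_le_zero rangeI)
    then show ?thesis by (simp add: c_def the_inv_into_f_f[OF inj])
  qed
  have eq: "(\<Sum>j\<le>CARD('n). c j * t ^ j) = a \<bullet> (\<chi> i. t ^ idx i) - b" for t
  proof -
    have "(\<Sum>j\<le>CARD('n). c j * t ^ j) = c 0 + (\<Sum>j\<in>{1..CARD('n)}. c j * t ^ j)"
    proof -
      have "{..CARD('n)} = insert 0 {1..CARD('n)}" by auto
      then show ?thesis by simp
    qed
    also have "(\<Sum>j\<in>{1..CARD('n)}. c j * t ^ j) = (\<Sum>i\<in>UNIV. c (idx i) * t ^ idx i)"
      unfolding img[symmetric] by (subst sum.reindex[OF inj]) simp
    also have "\<dots> = a \<bullet> (\<chi> i. t ^ idx i)" by (simp add: inner_vec_def ci)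
    finally show ?thesis by (simp add: c_def)
  qed
  obtain i where "a $ i \<noteq> 0" using a by (auto simp: vec_eq_iff)
  moreover have "idx i \<le> CARD('n)" using img by (metis atLeastAtMost_iff rangeI)
  ultimately have "\<exists>k. k \<le> CARD('n) \<and> c k \<noteq> 0" by (metis ci)
  then show "card {t. a \<bullet> (\<chi> i. t ^ idx i) = b} \<le> CARD('n)" "finite {t. a \<bullet> (\<chi> i. t ^ idx i) = b}"
    using polyfun_rootbound_card[of "CARD('n)" c] polyfun_rootbound_finite[of "CARD('n)" c]
    by (simp_all add: eq)
qed

text \<open>\<open>GREATEST\<close> yields a maximum only for a bounded property. Points on the
  moment curve supply the bound: fewer than \<open>k\<close> on either side of a hyperplane, at most
  the dimension on it.\<close>

lemma kneser_number_bound: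
  assumes l: "l \<ge> 1" and P: "\<forall>X :: (real ^ 'n::finite) set. finite X \<and> card X = n \<longrightarrow> (\<exists>T. kneser_transversal k l X T)"
  shows "n \<le> CARD('n) + 2 * k"
proof -
  obtain idx :: "'n \<Rightarrow> nat" where idx: "bij_betw idx UNIV {1..CARD('n)}"
    using ex_bij_betw_nat_finite_1[of "UNIV :: 'n set"] bij_betw_inv by (metis finite)
  define m :: "real \<Rightarrow> real ^ 'n" where "m t = (\<chi> i. t ^ idx i)" for t
  have "1 \<in> range idx"
    using idx zero_less_card_finite[where 'a='n] by (auto simp: bij_betw_def)
  then obtain j where j: "idx j = 1" by (metis imageE)
  have inj: "inj m"
  proof (rule injI)
    fix s t assume "m s = m t"
    then have "m s $ j = m t $ j" by simp
    then show "s = t" by (simp add: m_def j)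
  qed
  define X where "X = m ` real ` {..<n}"
  have "inj_on (\<lambda>i. m (real i)) {..<n}"
    using injD[OF inj] by (intro inj_onI) fastforce
  then have X: "finite X" "card X = n"
    by (simp_all add: X_def image_image card_image)
  from P[rule_format, OF conjI[OF X]] obtain T where T: "kneser_transversal k l X T" ..
  obtain a b where ab: "a \<noteq> 0" "card {x\<in>X. a \<bullet> x < b} < k" "card {x\<in>X. a \<bullet> x > b} < k"
    by (rule kneser_transversal_hyperplane[OF T l X(1)])
  have "{x\<in>X. a \<bullet> x = b} \<subseteq> m ` {t. a \<bullet> m t = b}" by (auto simp: X_def)
  then have "card {x\<in>X. a \<bullet> x = b} \<le> card (m ` {t. a \<bullet> m t = b})"
    using moment_curve_hyperplane(2)[OF idx ab(1), of b] by (intro card_mono) (auto simp: m_def)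
  also have "\<dots> \<le> CARD('n)"
    using moment_curve_hyperplane[OF idx ab(1), of b] card_image_le[of "{t. a \<bullet> m t = b}" m] by (simp add: m_def)
  finally have eq: "card {x\<in>X. a \<bullet> x = b} \<le> CARD('n)" .
  have "X = ({x\<in>X. a \<bullet> x < b} \<union> {x\<in>X. a \<bullet> x > b}) \<union> {x\<in>X. a \<bullet> x = b}" by auto
  then have "card X \<le> card ({x\<in>X. a \<bullet> x < b} \<union> {x\<in>X. a \<bullet> x > b}) + card {x\<in>X. a \<bullet> x = b}"
    by (metis (no_types, lifting) card_Un_le)
  moreover have "card ({x\<in>X. a \<bullet> x < b} \<union> {x\<in>X. a \<bullet> x > b}) \<le> card {x\<in>X. a \<bullet> x < b} + card {x\<in>X. a \<bullet> x > b}"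
    by (rule card_Un_le)
  ultimately show ?thesis using eq ab X by linarith
qed

lemma kneser_number_ge:
  assumes l: "l \<ge> 1" and n: "n \<ge> 1"
    and P: "\<And>X :: (real ^ 'n::finite) set. finite X \<Longrightarrow> card X = n \<Longrightarrow> \<exists>T. kneser_transversal k l X T"
  shows "n \<le> kneser_number TYPE(real ^ 'n) k l"
  unfolding kneser_number_def
proof (rule Greatest_le_nat)
  show "1 \<le> n \<and> (\<forall>X :: (real ^ 'n) set. finite X \<and> card X = n \<longrightarrow> (\<exists>T. kneser_transversal k l X T))"
    using n P by blast
  show "y \<le> CARD('n) + 2 * k"
    if "1 \<le> y \<and> (\<forall>X :: (real ^ 'n) set. finite X \<and> card X = y \<longrightarrow> (\<exists>T. kneser_transversal k l X T))" for y
    using kneser_number_bound[OF l] that by blast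
qed

section \<open>Lifting a line in space to a plane of codimension two\<close>

lemma ex_three_coordinates:
  assumes "CARD('n::finite) \<ge> 3"
  obtains i j k :: "'n::finite" where "distinct [i, j, k]"
proof -
  obtain S :: "'n set" where "card S = 3" using assms by (metis obtain_subset_with_card_n)
  then show ?thesis using that by (auto simp: card_3_iff)
qed

text \<open>The vector \<open>c\<close> is a multiple of the component of \<open>b\<close>
  orthogonal to \<open>a\<close>. Moving along it keeps \<open>a \<bullet> x\<close> and gives
  \<open>b \<bullet> x\<close> every value, so the second hyperplane cuts the first
  properly.\<close>

lemma aff_dim_two_hyperplanes:
  fixes a b :: "'e::euclidean_space"
  assumes ind: "\<And>\<alpha> \<beta>. \<alpha> *\<^sub>R a + \<beta> *\<^sub>R b = 0 \<Longrightarrow> \<alpha> = 0 \<and> \<beta> = 0"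
  shows "aff_dim {x. a \<bullet> x = \<alpha> \<and> b \<bullet> x = \<beta>} = int DIM('e) - 2"
proof -
  have a: "a \<noteq> 0" and b: "b \<noteq> 0" using ind[of 1 0] ind[of 0 1] by auto
  define c where "c = (a \<bullet> a) *\<^sub>R b - (a \<bullet> b) *\<^sub>R a"
  have "c \<noteq> 0" using ind[of "- (a \<bullet> b)" "a \<bullet> a"] a by (auto simp: c_def)
  have ac: "a \<bullet> c = 0" by (simp add: c_def inner_diff_right)
  have "c \<bullet> c = (a \<bullet> a) * (b \<bullet> c)" using ac by (simp add: c_def inner_diff_left inner_commute)
  then have bc: "b \<bullet> c \<noteq> 0" using \<open>c \<noteq> 0\<close> by auto
  define x0 where "x0 = (\<alpha> / (a \<bullet> a)) *\<^sub>R a"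
  have x0: "a \<bullet> x0 = \<alpha>" using a by (simp add: x0_def)
  define x where "x s = x0 + ((s - b \<bullet> x0) / (b \<bullet> c)) *\<^sub>R c" for s
  have x: "a \<bullet> x s = \<alpha>" "b \<bullet> x s = s" for s
    using bc by (simp_all add: x_def inner_add_right x0 ac)
  have "{x. a \<bullet> x = \<alpha>} \<inter> {x. b \<bullet> x = \<beta>} \<noteq> {}" "\<not> {x. a \<bullet> x = \<alpha>} \<subseteq> {x. b \<bullet> x = \<beta>}"
    using x[of \<beta>] x[of "\<beta> + 1"] by auto
  then have "aff_dim ({x. a \<bullet> x = \<alpha>} \<inter> {x. b \<bullet> x = \<beta>}) = aff_dim {x. a \<bullet> x = \<alpha>} - 1"
    by (subst aff_dim_affine_Int_hyperplane) (auto intro: affine_hyperplane)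
  then show ?thesis using a by (simp add: Collect_conj_eq)
qed

text \<open>The transversal is the preimage of \<open>q\<close> under the chart after the coordinate
  projection \<open>L\<close>. Convex hulls commute with this linear map; \<open>a\<close> and
  \<open>b\<close> are its two real components, obtained through the adjoints and independent since
  these are injective.\<close>

lemma codim_two_transversal:
  fixes X :: "(real ^ 'n::finite) set"
  assumes d: "CARD('n) \<ge> 3" and fin: "finite X" and e: "3*r = card X + e" and r: "r > 20*e"
    and k: "k + r = card X" "k \<ge> 1"
  shows "\<exists>T. kneser_transversal k 2 X T"
proof -
  obtain i j l :: 'n where ijl: "distinct [i, j, l]" using ex_three_coordinates[OF d] .
  define L :: "real ^ 'n \<Rightarrow> complex \<times> real" where "L x = (Complex (x $ i) (x $ j), x $ l)" for x
  define L' :: "complex \<times> real \<Rightarrow> real ^ 'n" where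
    "L' y = axis i (Re (fst y)) + axis j (Im (fst y)) + axis l (snd y)" for y
  have linL: "linear L" by (rule linearI) (auto simp: L_def complex_eq_iff)
  have linL': "linear L'" by (rule linearI) (auto simp: L'_def vec_eq_iff axis_def algebra_simps)
  have LL': "L (L' y) = y" for y
    using ijl by (auto simp: L_def L'_def axis_def prod_eq_iff complex_eq_iff)
  have adj: "L' y \<bullet> x = y \<bullet> L x" for x y
    by (simp add: L_def L'_def inner_add_left inner_axis' inner_prod_def inner_complex_def)
  obtain s v q where sv: "in_chart s v"
    and q: "\<And>S. S \<subseteq> X \<Longrightarrow> card S = k \<Longrightarrow> q \<in> convex hull ((\<lambda>x. chart s v (L x)) ` S)"
    using line_transversal_in_chart[OF fin e r k] by metis
  have linC: "linear (\<lambda>x. chart s v (L x))"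
    using linear_compose[OF linL linear_chart[of s v]] by (simp add: o_def)
  define a b where "a = L' (unchart s v 1)" and "b = L' (unchart s v \<i>)"
  have ax: "a \<bullet> x = Re (chart s v (L x))" and bx: "b \<bullet> x = Im (chart s v (L x))" for x
    by (simp_all add: a_def b_def adj inner_unchart inner_complex_def)
  have ind: "\<alpha> = 0 \<and> \<beta> = 0" if "\<alpha> *\<^sub>R a + \<beta> *\<^sub>R b = 0" for \<alpha> \<beta>
  proof -
    have "L (\<alpha> *\<^sub>R a + \<beta> *\<^sub>R b) = unchart s v (\<alpha> *\<^sub>R 1 + \<beta> *\<^sub>R \<i>)"
      by (simp add: a_def b_def linear_add[OF linL] linear_scale[OF linL] LL'
          linear_add[OF linear_unchart] linear_scale[OF linear_unchart])
    then have "unchart s v (\<alpha> *\<^sub>R 1 + \<beta> *\<^sub>R \<i>) = 0" using that linear_0[OF linL] by simp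
    then have "\<alpha> *\<^sub>R 1 + \<beta> *\<^sub>R \<i> = 0" by (rule unchart_eq_0[OF sv])
    then show ?thesis by (auto simp: complex_eq_iff)
  qed
  let ?T = "{x. a \<bullet> x = Re q \<and> b \<bullet> x = Im q}"
  have "kneser_transversal k 2 X ?T"
    unfolding kneser_transversal_def
  proof (intro conjI allI impI)
    show "affine ?T" by (simp add: Collect_conj_eq affine_Int affine_hyperplane)
    show "aff_dim ?T = int DIM(real ^ 'n) - int 2" using ind by (subst aff_dim_two_hyperplanes) auto
    fix S assume "S \<subseteq> X" "card S = k"
    then have "q \<in> convex hull ((\<lambda>x. chart s v (L x)) ` S)" by (rule q)
    also have "\<dots> = (\<lambda>x. chart s v (L x)) ` (convex hull S)"
      by (rule convex_hull_linear_image[OF linC, symmetric])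
    finally obtain y where "y \<in> convex hull S" "q = chart s v (L y)" by auto
    then show "?T \<inter> convex hull S \<noteq> {}" by (auto simp: ax bx)
  qed
  then show ?thesis ..
qed

theorem mainTheorem6:
  assumes "CARD('n::finite) \<ge> 3"
  shows "\<exists>k0\<ge>1. \<forall>k\<ge>k0.
    \<not> (int (kneser_number TYPE(real ^ 'n) k 2)
         = int CARD('n) - 2 + int k + \<lceil>real k / 2\<rceil> - 1)"
proof (intro exI[of _ "100 * CARD('n)"] conjI allI impI)
  show "1 \<le> 100 * CARD('n)" using assms by simp
  fix k assume k: "100 * CARD('n) \<le> k"
  define h where "h = (k + 1) div 2"
  have hk: "2 * h \<ge> k" "2 * h \<le> k + 1" by (auto simp: h_def)
  have h: "\<lceil>real k / 2\<rceil> = int h"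
    using hk by (intro ceiling_unique) linarith+
  \<comment> \<open>Here \<open>n\<close> is one more than the disputed value, and
    \<open>e = 3 * r - n\<close> is \<open>2 * d - 4\<close> or \<open>2 * d - 3\<close> by the
    parity of \<open>k\<close>, where \<open>d\<close> is the dimension. The factor 100 is generous:
    it gives \<open>r > 50 * d\<close>, while \<open>20 * e < 40 * d\<close>.\<close>
  define r e n where "r = CARD('n) - 2 + h" and "e = 2 * r - k" and "n = k + r"
  have "n \<le> kneser_number TYPE(real ^ 'n) k 2"
  proof (rule kneser_number_ge)
    show "\<exists>T. kneser_transversal k 2 X T" if "finite X" "card X = n" for X :: "(real ^ 'n) set"
      using that assms k hk by (intro codim_two_transversal[where r = r and e = e]) (auto simp: r_def e_def n_def)
  qed (use assms k in \<open>auto simp: n_def\<close>)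
  then show "int (kneser_number TYPE(real ^ 'n) k 2) \<noteq> int CARD('n) - 2 + int k + \<lceil>real k / 2\<rceil> - 1"
    unfolding h n_def r_def using assms by linarith
qed

end
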